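(* Let $(D,T,L)$ be a triple and $k$ a positive integer. Then $D$ has a $(T,L)$-out-branching with at least $k$ leaves if and only if Algorithm $\mathcal{A}(D,T,L)$ with parameter $k$ (described in the context) returns YES.
   Context: Digraph terminology: $V(D)$, $A(D)$ are the vertex and arc sets. An out-tree of $D$ is a subgraph $T$ that is an oriented tree with exactly one vertex of in-degree zero (its root); the leaves of $T$ are its vertices of out-degree zero in $T$ (a one-vertex out-tree has its root as its unique leaf). $\mathrm{Leaf}(T)$ is the set of leaves and $\mathrm{Int}(T)=V(T)\setminus \mathrm{Leaf}(T)$. An out-branching is a spanning out-tree. For a subgraph $H$ and vertex $x$, $N^+_H(x)$ is the set of out-neighbours of $x$ in $H$ and $A^+_H(x)=\{xy: y\in N^+_H(x)\}$. For an out-tree $T$ and a set $F$ of arcs, $T\cup F$ is the subgraph with arc set $A(T)\cup F$ and all incident vertices. A triple $(D,T,L)$ consists of a digraph $D$, an out-tree $T$ of $D$ and a set $L\subseteq V(D)\setminus \mathrm{Int}(T)$. A $(T,L)$-out-branching of $D$ is an out-branching $T'$ of $D$ with $A(T)\subseteq A(T')$, every vertex of $L$ a leaf of $T'$, and the same root as $T$. $\mathrm{ML}(D,T,L)$ is the maximum number of leaves of a $(T,L)$-out-branching of $D$, and $0$ if none exists. $\hat D=\hat D(T,L)$ is the subgraph of $D$ obtained by deleting all arcs leaving vertices of $L$ and all arcs not in $A(T)$ whose head lies in $V(T)$. For a triple $(D,T,L)$ and $x\in \mathrm{Leaf}(T)\setminus L$, $T^{\mathrm{root}}(x)$ is defined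 by: set $x':=x$; while $x'$ has exactly one out-neighbour $y$ in $\hat D(T,L)$ (recomputed for the current $T$), add the arc $x'y$ to $T$ and set $x':=y$; then add all arcs of $A^+_{\hat D(T,L)}(x')$ to $T$. $T^{\mathrm{root}}(x)$ is the out-tree rooted at $x$ formed by exactly the arcs added in this process. Algorithm $\mathcal{A}(D,T,L)$ with parameter $k$: (1) If $\mathrm{ML}(D,T,L)=0$, return NO. (2) While there is $x\in \mathrm{Leaf}(T)\setminus L$ with $\mathrm{ML}(D,T,L\cup\{x\})=0$, add the arcs $A^+_{\hat D(T,L)}(x)$ to $T$. (3) If $|L|\ge k$ return YES. If $|\mathrm{Leaf}(T)|\ge k$ return YES. If $\mathrm{Leaf}(T)\subseteq L$ return NO. (4) Choose a vertex $x\in\mathrm{Leaf}(T)\setminus L$. Let $B_1:=\mathcal{A}(D,T,L\cup\{x\})$ and $B_2:=$ NO. If $|\mathrm{Leaf}(T^{\mathrm{root}}(x))|\ge 2$, let $B_2:=\mathcal{A}(D,T\cup T^{\mathrm{root}}(x),L)$. Return YES if $B_1$ or $B_2$ is YES, otherwise NO.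
   Formalization: The claim fails for arbitrary triples (e.g. A(D)={ra,rb}, T=ra, L={a}, k=2); the formal theorem additionally assumes that every arc of D̂(T,L) leaving a vertex of Int(T) already belongs to T, which holds for every one-vertex T. *)

theory Defs
  imports "Graph_Theory.Graph_Theory" "HOL-Library.While_Combinator"
begin

text \<open>
  Digraphs are finite, without loops and without parallel arcs (\<open>pair_digraph\<close>), so that an arc
  \<open>xy\<close> is the pair \<open>(x, y)\<close>.

  The library predicate \<^const>\<open>tree\<close> is not usable for oriented trees: on a non-symmetric
  digraph it only excludes directed cycles, hence accepts e.g. the transitive triangle.
  Here cycles are excluded in the underlying undirected graph; the walks of length 2 along one edge
  and back, which are cycles of the symmetric closure, are not cycles of that graph.
\<close>

definition oriented_tree :: "'a pair_pre_digraph \<Rightarrow> bool" where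
  "oriented_tree T \<longleftrightarrow>
     connected (with_proj T) \<and>
     (\<forall>u v. (u, v) \<in> parcs T \<longrightarrow> (v, u) \<notin> parcs T) \<and>
     \<not> (\<exists>p. pre_digraph.cycle (with_proj (mk_symmetric (with_proj T))) p \<and> 3 \<le> length p)"

definition out_tree :: "'a pair_pre_digraph \<Rightarrow> 'a pair_pre_digraph \<Rightarrow> bool" where
  "out_tree D T \<longleftrightarrow>
     subgraph (with_proj T) (with_proj D) \<and> oriented_tree T \<and>
     (\<exists>!r. r \<in> pverts T \<and> in_degree (with_proj T) r = 0)"

definition tree_root :: "'a pair_pre_digraph \<Rightarrow> 'a" where
  "tree_root T = (THE r. r \<in> pverts T \<and> in_degree (with_proj T) r = 0)"

definition Leaf :: "'a pair_pre_digraph \<Rightarrow> 'a set" where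
  "Leaf T = {v \<in> pverts T. out_degree (with_proj T) v = 0}"

definition Int_verts :: "'a pair_pre_digraph \<Rightarrow> 'a set" where
  "Int_verts T = pverts T - Leaf T"

definition out_branching :: "'a pair_pre_digraph \<Rightarrow> 'a pair_pre_digraph \<Rightarrow> bool" where
  "out_branching D T \<longleftrightarrow> out_tree D T \<and> spanning (with_proj T) (with_proj D)"

definition triple :: "'a pair_pre_digraph \<Rightarrow> 'a pair_pre_digraph \<Rightarrow> 'a set \<Rightarrow> bool" where
  "triple D T L \<longleftrightarrow> pair_digraph D \<and> out_tree D T \<and> L \<subseteq> pverts D - Int_verts T"

definition TL_out_branching ::
  "'a pair_pre_digraph \<Rightarrow> 'a pair_pre_digraph \<Rightarrow> 'a set \<Rightarrow> 'a pair_pre_digraph \<Rightarrow> bool" where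
  "TL_out_branching D T L T' \<longleftrightarrow>
     out_branching D T' \<and> parcs T \<subseteq> parcs T' \<and> L \<subseteq> Leaf T' \<and> tree_root T' = tree_root T"

definition max_leaves :: "'a pair_pre_digraph \<Rightarrow> 'a pair_pre_digraph \<Rightarrow> 'a set \<Rightarrow> nat" where
  "max_leaves D T L =
     (if \<exists>T'. TL_out_branching D T L T'
      then Max {card (Leaf T') | T'. TL_out_branching D T L T'} else 0)"

definition hatD ::
  "'a pair_pre_digraph \<Rightarrow> 'a pair_pre_digraph \<Rightarrow> 'a set \<Rightarrow> 'a pair_pre_digraph" where
  "hatD D T L =
     \<lparr> pverts = pverts D,
       parcs = parcs D - {(u, v). u \<in> L} - {(u, v). (u, v) \<notin> parcs T \<and> v \<in> pverts T} \<rparr>"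

definition out_nbrs :: "'a pair_pre_digraph \<Rightarrow> 'a \<Rightarrow> 'a set" where
  "out_nbrs H x = {y. (x, y) \<in> parcs H}"

definition out_nbr_arcs :: "'a pair_pre_digraph \<Rightarrow> 'a \<Rightarrow> ('a \<times> 'a) set" where
  "out_nbr_arcs H x = {(x, y) | y. y \<in> out_nbrs H x}"

text \<open>
  The vertices of \<open>T\<close> are kept, so that adding no arcs to a one-vertex out-tree leaves it unchanged.
\<close>

definition add_arcs :: "'a pair_pre_digraph \<Rightarrow> ('a \<times> 'a) set \<Rightarrow> 'a pair_pre_digraph" where
  "add_arcs T F = \<lparr> pverts = pverts T \<union> fst ` F \<union> snd ` F, parcs = parcs T \<union> F \<rparr>"

text \<open>
  State of the loop: the current out-tree \<open>T\<close>, the graph \<open>R\<close> of the arcs added so far, starting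
  from the single vertex \<open>x\<close>, and the current vertex \<open>x'\<close>. The result is \<^const>\<open>None\<close> if the loop
  does not terminate.
\<close>

definition T_root ::
  "'a pair_pre_digraph \<Rightarrow> 'a pair_pre_digraph \<Rightarrow> 'a set \<Rightarrow> 'a \<Rightarrow> 'a pair_pre_digraph option" where
  "T_root D T L x =
     map_option (\<lambda>(T, R, x'). add_arcs R (out_nbr_arcs (hatD D T L) x'))
       (while_option
          (\<lambda>(T, R, x'). card (out_nbrs (hatD D T L) x') = 1)
          (\<lambda>(T, R, x').
             let y = the_elem (out_nbrs (hatD D T L) x')
             in (add_arcs T {(x', y)}, add_arcs R {(x', y)}, y))
          (T, \<lparr> pverts = {x}, parcs = {} \<rparr>, x))"

text \<open>
  The algorithm leaves open which vertex is taken in steps (2) and (4). A choice rule resolves this;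
  its arguments are the current \<open>T\<close> and \<open>L\<close> and the set of admissible vertices. Rules that depend
  on the current \<open>(T, L)\<close> only are fully general, because no pair \<open>(T, L)\<close> occurs at two different
  choice points of a run.
\<close>

type_synonym 'a choice = "'a pair_pre_digraph \<Rightarrow> 'a set \<Rightarrow> 'a set \<Rightarrow> 'a"

definition choice_rule :: "'a choice \<Rightarrow> bool" where
  "choice_rule pick \<longleftrightarrow> (\<forall>T L S. S \<noteq> {} \<longrightarrow> pick T L S \<in> S)"

definition forced ::
  "'a pair_pre_digraph \<Rightarrow> 'a pair_pre_digraph \<Rightarrow> 'a set \<Rightarrow> 'a set" where
  "forced D T L = {x \<in> Leaf T - L. max_leaves D T (L \<union> {x}) = 0}"

definition extend_forced ::
  "'a choice \<Rightarrow> 'a pair_pre_digraph \<Rightarrow> 'a pair_pre_digraph \<Rightarrow> 'a set \<Rightarrow>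
     'a pair_pre_digraph option" where
  "extend_forced pick D T L =
     while_option
       (\<lambda>T. forced D T L \<noteq> {})
       (\<lambda>T. add_arcs T (out_nbr_arcs (hatD D T L) (pick T L (forced D T L))))
       T"

datatype answer = YES | NO

text \<open>
  \<^const>\<open>None\<close> stands for a run that does not terminate.
\<close>

partial_function (option) algA ::
  "'a choice \<Rightarrow> nat \<Rightarrow> 'a pair_pre_digraph \<Rightarrow> 'a pair_pre_digraph \<Rightarrow> 'a set \<Rightarrow> answer option"
where
  "algA pick k D T L =
     (if max_leaves D T L = 0 then Some NO
      else Option.bind (extend_forced pick D T L) (\<lambda>T.
        if card L \<ge> k then Some YES
        else if card (Leaf T) \<ge> k then Some YES
        else if Leaf T \<subseteq> L then Some NO
        else
          let x = pick T L (Leaf T - L) in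
          Option.bind (T_root D T L x) (\<lambda>R.
          Option.bind (algA pick k D T (L \<union> {x})) (\<lambda>B1.
          Option.bind
            (if card (Leaf R) \<ge> 2 then algA pick k D (add_arcs T (parcs R)) L else Some NO) (\<lambda>B2.
          Some (if B1 = YES \<or> B2 = YES then YES else NO))))))"

text \<open>
  Every arc that \<open>D\<close> offers to an internal vertex of \<open>T\<close> already belongs to \<open>T\<close>. The algorithm
  only ever extends \<open>T\<close> at leaves, by all their available arcs, so it preserves this property, and
  every one-vertex out-tree \<open>T\<close> has it. For triples without it the algorithm can err: if \<open>D\<close> has the
  arcs \<open>ra\<close> and \<open>rb\<close>, \<open>T\<close> the single arc \<open>ra\<close>, \<open>L = {a}\<close> and \<open>k = 2\<close>, then \<open>D\<close> itself is a
  \<open>(T, L)\<close>-out-branching with two leaves, but \<open>Leaf T \<subseteq> L\<close> makes the algorithm return NO.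
\<close>

definition saturated :: "'a pair_pre_digraph \<Rightarrow> 'a pair_pre_digraph \<Rightarrow> 'a set \<Rightarrow> bool" where
  "saturated D T L \<longleftrightarrow> (\<forall>x \<in> Int_verts T. out_nbr_arcs (hatD D T L) x \<subseteq> parcs T)"

end

theory Submission
  imports Defs
begin

text \<open>
  An out-tree is an arborescence: one root, unique parents, everything reachable from the root.
  Saturation says that no arc of \<open>D\<close> leaves an internal vertex of \<open>T\<close> for a vertex outside \<open>T\<close>.
  Let \<open>x\<close> be a leaf of \<open>T\<close> outside \<open>L\<close>. A \<open>(T, L)\<close>-out-branching in which \<open>x\<close> is not a leaf can
  be changed, by moving all out-neighbours of \<open>x\<close> outside \<open>T\<close> below \<open>x\<close>, into one that contains
  all of these arcs and has no fewer leaves; this justifies the forced extensions and the single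
  steps of \<open>T_root(x)\<close>. If instead the branching ends in a leaf somewhere along the unbranched path of
  \<open>T_root(x)\<close>, then \<open>x\<close> itself can be made a leaf without losing leaves, because some
  \<open>(T, L \<union> {x})\<close>-out-branching exists. Both recursive calls enlarge \<open>L\<close> or \<open>T\<close>.
\<close>

section \<open>Out-trees as arborescences\<close>

text \<open>A relational form of out-trees with the root as a parameter. Unique parents and
  reachability from the root are what all exchange arguments use; acyclicity follows from
  them.\<close>

definition arborescence :: "'a \<Rightarrow> 'a pair_pre_digraph \<Rightarrow> bool" where
  "arborescence r T \<longleftrightarrow>
     r \<in> pverts T \<and> parcs T \<subseteq> pverts T \<times> pverts T \<and> (\<forall>u. (u, r) \<notin> parcs T) \<and>
     (\<forall>u u' v. (u, v) \<in> parcs T \<longrightarrow> (u', v) \<in> parcs T \<longrightarrow> u = u') \<and>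
     (\<forall>v \<in> pverts T. (r, v) \<in> (parcs T)\<^sup>*)"

lemma arborescenceD:
  assumes "arborescence r T"
  shows "r \<in> pverts T"
    and "(u, v) \<in> parcs T \<Longrightarrow> u \<in> pverts T"
    and "(u, v) \<in> parcs T \<Longrightarrow> v \<in> pverts T"
    and "(u, r) \<notin> parcs T"
    and "(u, v) \<in> parcs T \<Longrightarrow> (u', v) \<in> parcs T \<Longrightarrow> u = u'"
    and "v \<in> pverts T \<Longrightarrow> (r, v) \<in> (parcs T)\<^sup>*"
  using assms unfolding arborescence_def by blast+

text \<open>A cycle through a vertex enters it from its only parent and hence passes through the
  parent too. Going up in this way it would reach the root, which no arc enters.\<close>

lemma arborescence_acyclic:
  assumes T: "arborescence r T"
  shows "acyclic (parcs T)"
proof -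
  have "(v, v) \<notin> (parcs T)\<^sup>+" if "(r, v) \<in> (parcs T)\<^sup>*" for v
    using that
  proof (induction rule: rtrancl_induct)
    case base
    show ?case using arborescenceD(4)[OF T] by (meson tranclD2)
  next
    case (step y z)
    show ?case
    proof
      assume "(z, z) \<in> (parcs T)\<^sup>+"
      then obtain w where "(z, w) \<in> (parcs T)\<^sup>*" "(w, z) \<in> parcs T"
        by (meson tranclD2)
      moreover from this have "w = y" using arborescenceD(5)[OF T] step.hyps by blast
      ultimately have "(y, y) \<in> (parcs T)\<^sup>+" using step.hyps by (meson rtrancl_into_trancl2)
      with step.IH show False by simp
    qed
  qed
  moreover have "(r, v) \<in> (parcs T)\<^sup>*" if "(v, v) \<in> (parcs T)\<^sup>+" for v
    using that arborescenceD(2,6)[OF T] by (meson tranclD)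
  ultimately show ?thesis unfolding acyclic_def by blast
qed

section \<open>Degrees, leaves and the root in terms of arcs\<close>

lemma in_degree_eq_0_iff:
  "finite (parcs T) \<Longrightarrow> in_degree (with_proj T) v = 0 \<longleftrightarrow> (\<forall>u. (u, v) \<notin> parcs T)"
  unfolding in_degree_def in_arcs_def by auto

text \<open>Finiteness matters since degrees are cardinalities and \<open>card\<close> is 0 on
  infinite sets.\<close>

lemma mem_Leaf_iff:
  "finite (parcs T) \<Longrightarrow> v \<in> Leaf T \<longleftrightarrow> v \<in> pverts T \<and> (\<forall>w. (v, w) \<notin> parcs T)"
  unfolding Leaf_def out_degree_def out_arcs_def by auto

lemma arborescence_root_unique:
  assumes "arborescence r T" "v \<in> pverts T" "\<forall>u. (u, v) \<notin> parcs T"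
  shows "v = r"
  using assms by (metis arborescenceD(6) rtranclE)

lemma tree_root_arborescence:
  assumes "arborescence r T" "finite (parcs T)"
  shows "tree_root T = r"
  unfolding tree_root_def in_degree_eq_0_iff[OF assms(2)]
  using arborescenceD(1,4)[OF assms(1)] arborescence_root_unique[OF assms(1)]
  by (intro the_equality) blast+

section \<open>Cycles of the underlying undirected graph\<close>

lemma mk_symmetric_with_proj:
  "parcs (mk_symmetric (with_proj T)) = parcs T \<union> (parcs T)\<inverse>"
  by (auto simp: parcs_mk_symmetric)

lemma pcas_tl_pawalk_verts: "pcas u p v \<Longrightarrow> tl (pawalk_verts u p) = map snd p"
proof (induction p arbitrary: u)
  case (Cons e p)
  then show ?case by (cases p) auto
qed simp

text \<open>Turns the library notion into a statement about a list of arcs. The start of a nonempty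
  walk is the tail of an arc, so well-formedness makes it a vertex.\<close>

lemma cycle_with_proj_iff:
  assumes "parcs T \<subseteq> pverts T \<times> pverts T"
  shows "pre_digraph.cycle (with_proj T) p \<longleftrightarrow>
    p \<noteq> [] \<and> set p \<subseteq> parcs T \<and> distinct (map snd p) \<and> (\<exists>u. pcas u p u)"
proof -
  have "u \<in> pverts T" if "p \<noteq> []" "set p \<subseteq> parcs T" "pcas u p u" for u
    using that assms by (cases p) auto
  then show ?thesis
    unfolding pre_digraph.cycle_def pre_digraph.awalk_def awalk_verts_with_proj_eq
      cas_with_proj_eq with_proj_simps
    using pcas_tl_pawalk_verts by metis
qed

lemma pcas_nth_Suc: "pcas u p v \<Longrightarrow> Suc i < length p \<Longrightarrow> fst (p ! Suc i) = snd (p ! i)"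
proof (induction p arbitrary: u i)
  case (Cons e p)
  then show ?case by (cases i; cases p) auto
qed simp

lemma pcas_last: "pcas u p v \<Longrightarrow> p \<noteq> [] \<Longrightarrow> snd (last p) = v"
  by (induction p arbitrary: u) auto

lemma pcas_append: "pcas u (p @ q) v \<longleftrightarrow> (\<exists>w. pcas u p w \<and> pcas w q v)"
  by (induction p arbitrary: u) auto

text \<open>Cyclic indexing gives every arc of a closed walk a successor, including the last
  one.\<close>

lemma pcas_closed_nth:
  assumes "pcas u p u" "i < length p"
  shows "fst (p ! (Suc i mod length p)) = snd (p ! i)"
proof (cases "Suc i < length p")
  case True
  then show ?thesis using assms pcas_nth_Suc by fastforce
next
  case False
  then have i: "Suc i = length p" using assms by simp
  then have "snd (p ! i) = u" using assms pcas_last[of u p u]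
    by (metis last_conv_nth diff_Suc_1 length_0_conv nat.distinct(1))
  moreover have "fst (p ! 0) = u" using assms by (cases p) auto
  ultimately show ?thesis using i by simp
qed

text \<open>Among the vertices of a cycle choose \<open>w\<close> with no child on the cycle. Both
  neighbours of \<open>w\<close> on the cycle are then parents of \<open>w\<close>, hence equal,
  which is impossible for at least three distinct vertices.\<close>

lemma arborescence_no_cycle:
  assumes T: "arborescence r T" and fin: "finite (parcs T)"
    and p: "set p \<subseteq> parcs T \<union> (parcs T)\<inverse>" "distinct (map snd p)" "pcas u p u" "3 \<le> length p"
  shows False
proof -
  let ?n = "length p" and ?W = "snd ` set p"
  have "wf ((parcs T)\<inverse>)"
    by (rule finite_acyclic_wf_converse[OF fin arborescence_acyclic[OF T]])
  moreover have "?W \<noteq> {}" using p(4) by auto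
  ultimately obtain w where w: "w \<in> ?W" "\<And>y. (w, y) \<in> parcs T \<Longrightarrow> y \<notin> ?W"
    by (metis converse_iff wfE_min')
  then obtain i where i: "i < ?n" "snd (p ! i) = w" by (metis imageE in_set_conv_nth)
  \<comment> \<open>Arc \<open>i\<close> ends in \<open>w\<close>; \<open>h\<close> is the cyclic
    predecessor of \<open>i\<close> and \<open>j\<close> its successor. Adding \<open>?n\<close>
    before subtracting 1 avoids truncation at \<open>i = 0\<close>.\<close>
  define h where "h = (i + ?n - 1) mod ?n"
  define j where "j = Suc i mod ?n"
  have len: "h < ?n" "j < ?n" unfolding h_def j_def using p(4) by (auto intro!: mod_less_divisor)
  have "Suc h mod ?n = i"
    unfolding h_def using i(1) p(4) by (cases i) (simp_all add: mod_Suc_eq)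
  then have h: "fst (p ! i) = snd (p ! h)" using pcas_closed_nth[OF p(3) len(1)] by simp
  have j: "fst (p ! j) = w" using pcas_closed_nth[OF p(3) i(1)] i(2) j_def by simp
  have "snd (p ! h) \<in> ?W" "snd (p ! j) \<in> ?W" using len by simp_all
  moreover have "(snd (p ! h), w) \<in> parcs T \<union> (parcs T)\<inverse>"
    using p(1) i h by (metis nth_mem prod.collapse subsetD)
  moreover have "(w, snd (p ! j)) \<in> parcs T \<union> (parcs T)\<inverse>"
    using p(1) len j by (metis nth_mem prod.collapse subsetD)
  ultimately have "(snd (p ! h), w) \<in> parcs T" "(snd (p ! j), w) \<in> parcs T"
    using w(2) by auto
  then have "snd (p ! h) = snd (p ! j)" using arborescenceD(5)[OF T] by blast
  \<comment> \<open>Heads are distinct, so equal heads force equal indices; but \<open>i - 1\<close>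
    and \<open>i + 1\<close> differ modulo \<open>?n \<ge> 3\<close>.\<close>
  then have "h = j" using p(2) len by (metis length_map nth_eq_iff_index_eq nth_map)
  then show False
    using i(1) p(4) unfolding h_def j_def
    by (cases i) (auto simp: mod_Suc mod_if split: if_splits)
qed

lemma arborescence_oriented_tree:
  assumes T: "arborescence r T" and fin: "finite (parcs T)"
  shows "oriented_tree T"
proof -
  interpret T: pair_wf_digraph T
    using arborescenceD(2,3)[OF T] by unfold_locales auto
  let ?S = "mk_symmetric (with_proj T)"
  interpret S: pair_wf_digraph ?S by (rule T.wellformed_mk_symmetric)
  have reach: "r \<rightarrow>\<^sup>*\<^bsub>?S\<^esub> v" if "v \<in> pverts T" for v
  proof (rule T.reachable_mk_symmetricI)
    show "r \<rightarrow>\<^sup>*\<^bsub>T\<^esub> v"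
      using arborescenceD(1,6)[OF T] that by (simp add: T.reachable_conv)
  qed
  have "u \<rightarrow>\<^sup>*\<^bsub>?S\<^esub> v" if "u \<in> pverts T" "v \<in> pverts T" for u v
    using S.reachable_trans[OF symmetric_reachable[OF symmetric_mk_symmetric reach[OF that(1)]]
       reach[OF that(2)]] .
  then have "connected (with_proj T)"
    unfolding connected_def strongly_connected_def using arborescenceD(1)[OF T] by auto
  moreover have "(v, u) \<notin> parcs T" if "(u, v) \<in> parcs T" for u v
    using arborescence_acyclic[OF T] that unfolding acyclic_def by (meson r_into_trancl' trancl_into_trancl)
  moreover have "\<not> (pre_digraph.cycle (with_proj ?S) p \<and> 3 \<le> length p)" for p
  proof -
    have "parcs ?S \<subseteq> pverts ?S \<times> pverts ?S" using S.in_arcsD1 S.in_arcsD2 by auto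
    then show ?thesis
      unfolding cycle_with_proj_iff[OF \<open>parcs ?S \<subseteq> _\<close>] mk_symmetric_with_proj
      using arborescence_no_cycle[OF T fin] by metis
  qed
  ultimately show ?thesis unfolding oriented_tree_def by blast
qed

text \<open>Walking backwards along arcs stops by acyclicity, and it can stop only at the unique
  source \<open>r\<close>, so \<open>r\<close> reaches everything. Two parents of a vertex would be
  joined through \<open>r\<close> by a path avoiding that vertex, which closes an undirected
  cycle.\<close>

lemma oriented_tree_arborescence:
  assumes tree: "oriented_tree T" and fin: "finite (parcs T)"
    and wf: "parcs T \<subseteq> pverts T \<times> pverts T" and loopfree: "\<And>u. (u, u) \<notin> parcs T"
    and r: "r \<in> pverts T" "\<And>u. (u, r) \<notin> parcs T"
    and r_unique: "\<And>v. v \<in> pverts T \<Longrightarrow> (\<And>u. (u, v) \<notin> parcs T) \<Longrightarrow> v = r"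
  shows "arborescence r T"
proof -
  let ?S = "mk_symmetric (with_proj T)"
  have wf_S: "parcs ?S \<subseteq> pverts ?S \<times> pverts ?S"
    unfolding mk_symmetric_with_proj using wf by auto
  have no_cycle: "\<not> (set p \<subseteq> parcs T \<union> (parcs T)\<inverse> \<and> distinct (map snd p) \<and> pcas u p u \<and>
      3 \<le> length p)" for p u
  proof (cases "p = []")
    case False
    then show ?thesis
      using tree unfolding oriented_tree_def cycle_with_proj_iff[OF wf_S] mk_symmetric_with_proj
      by blast
  qed simp
  have asym: "(v, u) \<notin> parcs T" if "(u, v) \<in> parcs T" for u v
    using tree that unfolding oriented_tree_def by blast
  have acyclic: "acyclic (parcs T)"
  proof (rule ccontr)
    assume "\<not> acyclic (parcs T)"
    then obtain x where x: "(x, x) \<in> (parcs T)\<^sup>+" unfolding acyclic_def by blast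
    interpret T: pair_wf_digraph T using wf by unfold_locales auto
    have "\<exists>p. T.closed_w p"
      using x T.reachable1_awalk[of x x] unfolding T.closed_w_def by auto
    then obtain p where "T.cycle p" using T.closed_w_imp_cycle by blast
    then obtain u where p: "p \<noteq> []" "set p \<subseteq> parcs T" "distinct (map snd p)" "pcas u p u"
      unfolding cycle_with_proj_iff[OF wf] by blast
    \<comment> \<open>A longer directed cycle is a forbidden undirected one; lengths 1 and 2 are
      excluded by loop-freeness and asymmetry.\<close>
    have "length p < 3" using no_cycle[of p u] p by auto
    moreover have "length p \<noteq> 0" using p(1) by simp
    ultimately have "length p = 1 \<or> length p = 2" by linarith
    then obtain a b c d where "p = [(a, b)] \<or> p = [(a, b), (c, d)]"
      by (auto simp: length_Suc_conv numeral_2_eq_2)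
    then show False
      using p(2,4) loopfree asym by auto
  qed
  have reach: "(r, v) \<in> (parcs T)\<^sup>*" if "v \<in> pverts T" for v
    using finite_acyclic_wf[OF fin acyclic] that
  proof (induction v rule: wf_induct_rule)
    case (less v)
    show ?case
    proof (cases "v = r")
      case False
      then obtain u where "(u, v) \<in> parcs T" using r_unique less.prems by blast
      with less.IH[of u] wf show ?thesis by (auto intro: rtrancl_into_rtrancl)
    qed simp
  qed
  have "u = u'" if uv: "(u, v) \<in> parcs T" "(u', v) \<in> parcs T" for u u' v
  proof (rule ccontr)
    assume "u \<noteq> u'"
    \<comment> \<open>\<open>H\<close> is the underlying undirected graph with \<open>v\<close>
      removed.\<close>
    define H where "H = \<lparr>pverts = pverts T - {v},
      parcs = {(a, b). (a, b) \<in> parcs T \<union> (parcs T)\<inverse> \<and> a \<noteq> v \<and> b \<noteq> v}\<rparr>"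
    interpret H: pair_wf_digraph H using wf by unfold_locales (auto simp: H_def)
    have symH: "sym (parcs H)" unfolding H_def by (auto intro: symI)
    \<comment> \<open>All vertices on the path from \<open>r\<close> to a proper ancestor of
      \<open>v\<close> are proper ancestors of \<open>v\<close>, and acyclicity keeps
      \<open>v\<close> off the path.\<close>
    have avoid: "(r, w) \<in> (parcs H)\<^sup>*" if w: "(w, v) \<in> (parcs T)\<^sup>+" for w
    proof -
      have "w \<in> pverts T" using w wf by (meson mem_Sigma_iff subsetD tranclD)
      from reach[OF this] w show ?thesis
      proof (induction rule: rtrancl_induct)
        case (step y z)
        have *: "(y, v) \<in> (parcs T)\<^sup>+" using step by (meson trancl_into_trancl2)
        moreover have "y \<noteq> v" "z \<noteq> v" using * step.prems acyclic unfolding acyclic_def by auto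
        ultimately show ?case
          using step unfolding H_def by (auto intro: rtrancl.rtrancl_into_rtrancl)
      qed simp
    qed
    have "(u, r) \<in> (parcs H)\<^sup>*" "(r, u') \<in> (parcs H)\<^sup>*"
      using avoid[of u] avoid[of u'] uv sym_rtrancl[OF symH] by (auto dest: symD)
    then have "(u, u') \<in> (parcs H)\<^sup>*" by simp
    moreover have "u \<in> pverts H" using uv wf loopfree by (auto simp: H_def)
    ultimately have "u \<rightarrow>\<^sup>*\<^bsub>H\<^esub> u'" by (simp add: H.reachable_conv')
    then obtain p where "H.apath u p u'" using H.reachable_apath by blast
    then have p: "set p \<subseteq> parcs H" "pcas u p u'" "distinct (pawalk_verts u p)"
      unfolding H.apath_def H.awalk_def by auto
    have vs: "pawalk_verts u p = u # map snd p"
      using pcas_tl_pawalk_verts[OF p(2)] p(2) by (cases p) auto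
    \<comment> \<open>The path from \<open>u\<close> to \<open>u'\<close> is closed through
      \<open>v\<close>; the first arc is a reversed arc of \<open>T\<close>. Since
      \<open>u \<noteq> u'\<close>, the path is nonempty and the length is at least 3.\<close>
    let ?c = "(v, u) # p @ [(u', v)]"
    have "p \<noteq> []" using p(2) \<open>u \<noteq> u'\<close> by auto
    then have "3 \<le> length ?c" by (cases p) auto
    moreover have "v \<notin> snd ` set p" using p(1) unfolding H_def by auto
    then have "distinct (map snd ?c)" using p(3) vs \<open>u \<in> pverts H\<close> by (auto simp: H_def)
    moreover have "pcas v ?c v"
      using p(2) unfolding pcas_append pcas.simps by (simp only: fst_conv snd_conv) blast
    moreover have "set ?c \<subseteq> parcs T \<union> (parcs T)\<inverse>" using p(1) uv unfolding H_def by auto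
    ultimately show False using no_cycle by blast
  qed
  with wf r reach show ?thesis unfolding arborescence_def by blast
qed

text \<open>The bridge to \<open>arborescence\<close>. Finiteness and loop-freeness of
  \<open>D\<close> pass to \<open>T\<close> and provide the side conditions of the two preceding
  lemmas.\<close>

lemma out_tree_iff:
  assumes D: "pair_digraph D"
  shows "out_tree D T \<longleftrightarrow>
    pverts T \<subseteq> pverts D \<and> parcs T \<subseteq> parcs D \<and> (\<exists>r. arborescence r T)"
proof -
  interpret D: pair_digraph D by (rule D)
  show ?thesis
  proof
    assume T: "out_tree D T"
    then have sub: "pverts T \<subseteq> pverts D" "parcs T \<subseteq> parcs D" "wf_digraph (with_proj T)"
      unfolding out_tree_def subgraph_def by auto
    have fin: "finite (parcs T)" using sub(2) D.pair_finite_arcs finite_subset by blast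
    from T obtain r where "r \<in> pverts T" "\<And>u. (u, r) \<notin> parcs T"
      "\<And>v. v \<in> pverts T \<Longrightarrow> (\<And>u. (u, v) \<notin> parcs T) \<Longrightarrow> v = r"
      unfolding out_tree_def in_degree_eq_0_iff[OF fin] by blast
    moreover have "parcs T \<subseteq> pverts T \<times> pverts T"
      using wf_digraph.wellformed[OF sub(3)] by auto
    moreover have "(u, u) \<notin> parcs T" for u using sub(2) D.pair_no_loops by fastforce
    moreover have "oriented_tree T" using T unfolding out_tree_def by blast
    ultimately have "arborescence r T" by (intro oriented_tree_arborescence[OF _ fin]) metis+
    with sub show "pverts T \<subseteq> pverts D \<and> parcs T \<subseteq> parcs D \<and> (\<exists>r. arborescence r T)" by blast
  next
    assume "pverts T \<subseteq> pverts D \<and> parcs T \<subseteq> parcs D \<and> (\<exists>r. arborescence r T)"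
    then obtain r where sub: "pverts T \<subseteq> pverts D" "parcs T \<subseteq> parcs D" and r: "arborescence r T"
      by blast
    have fin: "finite (parcs T)" using sub(2) D.pair_finite_arcs finite_subset by blast
    have "wf_digraph (with_proj T)" using arborescenceD(2,3)[OF r] by unfold_locales auto
    then have "subgraph (with_proj T) (with_proj D)"
      unfolding subgraph_def compatible_def using sub D.wf_digraph_axioms by simp
    moreover have "\<exists>!r. r \<in> pverts T \<and> in_degree (with_proj T) r = 0"
      unfolding in_degree_eq_0_iff[OF fin]
      using arborescenceD(1,4)[OF r] arborescence_root_unique[OF r] by blast
    ultimately show "out_tree D T"
      unfolding out_tree_def using arborescence_oriented_tree[OF r fin] by blast
  qed
qed

section \<open>Moving subtrees\<close>

text \<open>The vertex \<open>v\<close> is not the root, so it has a parent in \<open>T\<close>, and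
  this is its only parent in \<open>T'\<close>.\<close>

lemma arborescence_in_arc:
  assumes T: "arborescence r T" and T': "arborescence r T'" and sub: "parcs T \<subseteq> parcs T'"
    and "(u, v) \<in> parcs T'" "v \<in> pverts T"
  shows "(u, v) \<in> parcs T"
proof -
  have "v \<noteq> r" using assms arborescenceD(4)[OF T'] by blast
  then obtain u' where "(u', v) \<in> parcs T" using arborescence_root_unique[OF T] assms(5) by blast
  moreover from this have "u' = u" using arborescenceD(5)[OF T'] sub assms(4) by blast
  ultimately show ?thesis by simp
qed

text \<open>Going up in \<open>T'\<close> from a vertex of \<open>T\<close> never leaves
  \<open>T\<close>, by repeated use of \<open>arborescence_in_arc\<close>.\<close>

lemma arborescence_ancestor:
  assumes T: "arborescence r T" and T': "arborescence r T'" and sub: "parcs T \<subseteq> parcs T'"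
    and "(u, v) \<in> (parcs T')\<^sup>*" "v \<in> pverts T"
  shows "u \<in> pverts T \<and> (u, v) \<in> (parcs T)\<^sup>*"
  using assms(4)
proof (induction rule: converse_rtrancl_induct)
  case base
  then show ?case using assms(5) by simp
next
  case (step y z)
  then have "(y, z) \<in> parcs T" using arborescence_in_arc[OF T T' sub] by blast
  then show ?case using arborescenceD(2)[OF T] step.IH by (meson converse_rtrancl_into_rtrancl)
qed

lemma arborescence_leaf_below:
  assumes T: "arborescence r T" and fin: "finite (parcs T)" and "v \<in> pverts T"
  shows "\<exists>w \<in> Leaf T. (v, w) \<in> (parcs T)\<^sup>*"
  using finite_acyclic_wf_converse[OF fin arborescence_acyclic[OF T]] assms(3)
proof (induction v rule: wf_induct_rule)
  case (less v)
  show ?case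
  proof (cases "v \<in> Leaf T")
    case False
    then obtain w where w: "(v, w) \<in> parcs T" using less.prems mem_Leaf_iff[OF fin] by blast
    then have "w \<in> pverts T" using arborescenceD(3)[OF T] by blast
    with less.IH[of w] w show ?thesis by (meson converse_iff converse_rtrancl_into_rtrancl)
  qed blast
qed

text \<open>Send each leaf of \<open>T\<close> to a leaf of \<open>T'\<close> below it. This is
  injective: two leaves with a common descendant are comparable in \<open>T'\<close>, hence
  comparable in \<open>T\<close>, hence equal.\<close>

lemma card_Leaf_mono:
  assumes T: "arborescence r T" and T': "arborescence r T'" and sub: "parcs T \<subseteq> parcs T'"
    and fin: "finite (parcs T')" "finite (pverts T')" and verts: "pverts T \<subseteq> pverts T'"
  shows "card (Leaf T) \<le> card (Leaf T')"
proof -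
  have fin_T: "finite (parcs T)" using sub fin finite_subset by blast
  have "\<forall>l \<in> Leaf T. \<exists>w \<in> Leaf T'. (l, w) \<in> (parcs T')\<^sup>*"
    using arborescence_leaf_below[OF T' fin(1)] verts mem_Leaf_iff[OF fin_T] by blast
  then obtain f where f: "\<And>l. l \<in> Leaf T \<Longrightarrow> f l \<in> Leaf T' \<and> (l, f l) \<in> (parcs T')\<^sup>*"
    by metis
  have below: "l = l'" if "l \<in> Leaf T" "l' \<in> Leaf T" "(l, l') \<in> (parcs T')\<^sup>*" for l l'
  proof -
    have "(l, l') \<in> (parcs T)\<^sup>*"
      using arborescence_ancestor[OF T T' sub that(3)] that mem_Leaf_iff[OF fin_T] by blast
    then show ?thesis using that(1) mem_Leaf_iff[OF fin_T] by (meson converse_rtranclE)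
  qed
  have "inj_on f (Leaf T)"
  proof (rule inj_onI)
    fix l l' assume l: "l \<in> Leaf T" "l' \<in> Leaf T" "f l = f l'"
    \<comment> \<open>Unique parents make the ancestors of a vertex a chain.\<close>
    have "single_valued ((parcs T')\<inverse>)"
      using arborescenceD(5)[OF T'] by (auto intro: single_valuedI)
    moreover have "(f l, l) \<in> ((parcs T')\<inverse>)\<^sup>*" "(f l, l') \<in> ((parcs T')\<inverse>)\<^sup>*"
      using f[OF l(1)] f[OF l(2)] l(3) by (simp_all add: rtrancl_converse)
    ultimately have "(l, l') \<in> ((parcs T')\<inverse>)\<^sup>* \<or> (l', l) \<in> ((parcs T')\<inverse>)\<^sup>*"
      by (rule single_valued_confluent)
    then show "l = l'" using below[of l l'] below[of l' l] l(1,2) by (auto simp: rtrancl_converse)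
  qed
  moreover have "f ` Leaf T \<subseteq> Leaf T'" using f by blast
  moreover have "finite (Leaf T')" using fin(2) unfolding Leaf_def by simp
  ultimately show ?thesis by (rule card_inj_on_le)
qed

text \<open>The exchange operation: the subtrees below the vertices of \<open>S\<close> move along
  with them, and each vertex of \<open>S\<close> trades its old parent for \<open>x\<close>.\<close>

definition rehang :: "'a pair_pre_digraph \<Rightarrow> 'a \<Rightarrow> 'a set \<Rightarrow> 'a pair_pre_digraph" where
  "rehang T x S = \<lparr>pverts = pverts T, parcs = {(u, v) \<in> parcs T. v \<notin> S} \<union> {x} \<times> S\<rparr>"

lemma rehang_simps [simp]:
  "pverts (rehang T x S) = pverts T"
  "(u, v) \<in> parcs (rehang T x S) \<longleftrightarrow> (if v \<in> S then u = x else (u, v) \<in> parcs T)"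
  unfolding rehang_def by auto

lemma Leaf_rehang:
  assumes "finite (parcs T)" "finite (parcs (rehang T x S))"
  shows "Leaf T - {x} \<subseteq> Leaf (rehang T x S)"
  using mem_Leaf_iff[OF assms(1)] mem_Leaf_iff[OF assms(2)] by (auto split: if_splits)

text \<open>By \<open>no_anc\<close> the path from the root to \<open>x\<close> contains no vertex
  of \<open>S\<close> and survives. Any other path can be restarted from \<open>x\<close> at its
  last vertex in \<open>S\<close>.\<close>

lemma arborescence_rehang:
  assumes T: "arborescence r T" and x: "x \<in> pverts T" and S: "S \<subseteq> pverts T"
    and no_anc: "\<And>y. y \<in> S \<Longrightarrow> (y, x) \<notin> (parcs T)\<^sup>*"
  shows "arborescence r (rehang T x S)"
proof -
  let ?T = "rehang T x S"
  have "r \<notin> S" using no_anc arborescenceD(6)[OF T x] by blast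
  have x_reach: "(r, x) \<in> (parcs ?T)\<^sup>*"
  proof -
    have "(y, x) \<in> (parcs ?T)\<^sup>*" if "(y, x) \<in> (parcs T)\<^sup>*" for y
      using that
    proof (induction rule: converse_rtrancl_induct)
      case (step y z)
      then have "z \<notin> S" using no_anc by blast
      with step show ?case by (auto intro: converse_rtrancl_into_rtrancl)
    qed simp
    then show ?thesis using arborescenceD(6)[OF T x] by blast
  qed
  have "(r, v) \<in> (parcs ?T)\<^sup>*" if "(r, v) \<in> (parcs T)\<^sup>*" for v
    using that
  proof (induction rule: rtrancl_induct)
    case (step y z)
    show ?case
    proof (cases "z \<in> S")
      case True
      then show ?thesis using x_reach by (auto intro: rtrancl_into_rtrancl)
    next
      case False
      then show ?thesis using step by (auto intro: rtrancl_into_rtrancl)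
    qed
  qed simp
  then show ?thesis
    unfolding arborescence_def
    using arborescenceD[OF T] x S \<open>r \<notin> S\<close> by (auto split: if_splits)
qed

lemma arborescence_add_arcs:
  assumes T: "arborescence r T" and x: "x \<in> pverts T" and S: "S \<inter> pverts T = {}"
  shows "arborescence r (add_arcs T ({x} \<times> S))"
proof -
  let ?T = "add_arcs T ({x} \<times> S)"
  have "(r, v) \<in> (parcs ?T)\<^sup>*" if "v \<in> pverts T" for v
    using arborescenceD(6)[OF T that] by (rule rtrancl_mono[THEN subsetD, rotated]) (auto simp: add_arcs_def)
  moreover from this[OF x] have "(r, v) \<in> (parcs ?T)\<^sup>*" if "v \<in> S" for v
    using that by (auto simp: add_arcs_def intro: rtrancl_into_rtrancl)
  moreover have "pverts ?T = pverts T \<union> S" using x by (auto simp: add_arcs_def)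
  ultimately show ?thesis
    unfolding arborescence_def
    using arborescenceD[OF T] x S
    by (auto simp: add_arcs_def split: if_splits)
qed

lemma add_arcs_add_arcs: "add_arcs (add_arcs T F) F' = add_arcs T (F \<union> F')"
  unfolding add_arcs_def by auto

section \<open>Triples and their branchings in terms of arborescences\<close>

lemma triple_iff:
  assumes D: "pair_digraph D"
  shows "triple D T L \<longleftrightarrow> (\<exists>r. arborescence r T) \<and> pverts T \<subseteq> pverts D \<and> parcs T \<subseteq> parcs D \<and>
    L \<subseteq> pverts D \<and> (\<forall>x \<in> L. \<forall>y. (x, y) \<notin> parcs T)"
proof -
  interpret pair_digraph D by (rule D)
  have "L \<inter> Int_verts T = {} \<longleftrightarrow> (\<forall>x \<in> L. \<forall>y. (x, y) \<notin> parcs T)"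
    if "arborescence r T" "parcs T \<subseteq> parcs D" for r
    using that pair_finite_arcs arborescenceD(2)[OF that(1)] mem_Leaf_iff[of T]
    unfolding Int_verts_def by (blast dest: finite_subset)
  then show ?thesis unfolding triple_def out_tree_iff[OF D] using D by blast
qed

text \<open>The condition on the roots becomes a shared parameter \<open>r\<close>, because an
  arborescence determines its root.\<close>

lemma TL_out_branching_iff:
  assumes D: "pair_digraph D" and T: "arborescence r T" "parcs T \<subseteq> parcs D"
  shows "TL_out_branching D T L T' \<longleftrightarrow> arborescence r T' \<and> pverts T' = pverts D \<and>
    parcs T' \<subseteq> parcs D \<and> parcs T \<subseteq> parcs T' \<and> L \<subseteq> Leaf T'"
proof -
  interpret pair_digraph D by (rule D)
  have root: "tree_root T' = r'" if "arborescence r' T'" "parcs T' \<subseteq> parcs D" for r' T'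
    using tree_root_arborescence[OF that(1)] that(2) pair_finite_arcs finite_subset by blast
  have "out_branching D T' \<longleftrightarrow> out_tree D T' \<and> pverts T' = pverts D"
    unfolding out_branching_def spanning_def out_tree_def by auto
  then show ?thesis
    unfolding TL_out_branching_def out_tree_iff[OF D] using root[OF T] root[of _ T'] by auto
qed

text \<open>Threshold form of \<open>max_leaves\<close>; \<open>k = 0\<close> expresses mere
  existence of a branching.\<close>

definition has_branching ::
  "'a pair_pre_digraph \<Rightarrow> 'a pair_pre_digraph \<Rightarrow> 'a set \<Rightarrow> nat \<Rightarrow> bool" where
  "has_branching D T L k \<longleftrightarrow> (\<exists>T'. TL_out_branching D T L T' \<and> k \<le> card (Leaf T'))"

lemma branching_mono:
  assumes "TL_out_branching D T1 L1 T'" "parcs T \<subseteq> parcs T1" "tree_root T1 = tree_root T" "L \<subseteq> L1"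
  shows "TL_out_branching D T L T'"
  using assms unfolding TL_out_branching_def by auto

lemma has_branching_mono:
  assumes "has_branching D T1 L1 k" "parcs T \<subseteq> parcs T1" "tree_root T1 = tree_root T" "L \<subseteq> L1"
  shows "has_branching D T L k"
  using assms(1) branching_mono[OF _ assms(2-4)] unfolding has_branching_def by blast

lemma parcs_add_arcs [simp]: "parcs (add_arcs T F) = parcs T \<union> F"
  unfolding add_arcs_def by simp

lemma add_arcs_empty [simp]: "add_arcs T {} = T"
  unfolding add_arcs_def by simp

lemma out_nbr_arcs_eq: "out_nbr_arcs H x = {x} \<times> out_nbrs H x"
  unfolding out_nbr_arcs_def by auto

text \<open>The last assumption ensures that no old arc starts in \<open>S\<close>. It concerns
  tails only, so that it suits the graph \<open>R\<close> of \<open>T_root\<close>, for which just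
  this is tracked.\<close>

lemma Leaf_add_arcs:
  assumes "finite (parcs T)" "finite S" "S \<noteq> {}" "x \<in> pverts T" "S \<inter> pverts T = {}"
    and "fst ` parcs T \<subseteq> pverts T"
  shows "Leaf (add_arcs T ({x} \<times> S)) = Leaf T - {x} \<union> S"
proof -
  have *: "(a, b) \<notin> parcs T" if "a \<in> S" for a b
    using that assms(5,6) by force
  have "finite (parcs (add_arcs T ({x} \<times> S)))" using assms(1,2) by simp
  moreover have "pverts (add_arcs T ({x} \<times> S)) = pverts T \<union> S"
    using assms(4) by (auto simp: add_arcs_def)
  ultimately show ?thesis
    using assms(2-5) * by (auto simp: mem_Leaf_iff assms(1))
qed

lemma branching_insert_leaf_iff:
  "TL_out_branching D T (L \<union> {x}) T' \<longleftrightarrow> TL_out_branching D T L T' \<and> x \<in> Leaf T'"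
  unfolding TL_out_branching_def by auto

section \<open>Extending out-branchings\<close>

context
  fixes D :: "'a pair_pre_digraph"
  assumes D: "pair_digraph D"
begin

interpretation pair_digraph D by (rule D)

lemma tripleE:
  assumes "triple D T L"
  obtains r where "arborescence r T" "parcs T \<subseteq> parcs D" "pverts T \<subseteq> pverts D" "L \<subseteq> pverts D"
    "\<forall>x \<in> L. \<forall>y. (x, y) \<notin> parcs T" "L \<inter> Int_verts T = {}"
proof -
  have "L \<inter> Int_verts T = {}" using assms unfolding triple_def by blast
  with assms that show thesis unfolding triple_iff[OF D] by metis
qed

lemma finite_parcs: "parcs T \<subseteq> parcs D \<Longrightarrow> finite (parcs T)"
  using pair_finite_arcs by (rule finite_subset[rotated])

lemma finite_Leaf_branching:
  assumes "TL_out_branching D T L T'"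
  shows "finite (Leaf T')"
proof -
  have "pverts T' = pverts D"
    using assms unfolding TL_out_branching_def out_branching_def spanning_def by simp
  then show ?thesis using pair_finite_verts unfolding Leaf_def by simp
qed

text \<open>Every branching has a leaf, so the value 0 is never a maximum attained by a branching.
  The maximum is over a finite set, bounded by the number of vertices.\<close>

lemma max_leaves_eq_0_iff:
  assumes "triple D T L"
  shows "max_leaves D T L = 0 \<longleftrightarrow> \<not> (\<exists>T'. TL_out_branching D T L T')"
proof -
  obtain r where r: "arborescence r T" "parcs T \<subseteq> parcs D"
    using assms by (rule tripleE)
  let ?M = "{card (Leaf T') | T'. TL_out_branching D T L T'}"
  have "card (Leaf T') \<le> card (pverts D)" if "TL_out_branching D T L T'" for T'
    using that pair_finite_verts unfolding TL_out_branching_iff[OF D r] Leaf_def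
    by (auto intro: card_mono)
  then have fin: "finite ?M" by (auto intro: finite_subset[of _ "{.. card (pverts D)}"])
  have pos: "0 < card (Leaf T')" if T': "TL_out_branching D T L T'" for T'
  proof -
    have r': "arborescence r T'" "parcs T' \<subseteq> parcs D"
      using T' unfolding TL_out_branching_iff[OF D r] by auto
    have "Leaf T' \<noteq> {}"
      using arborescence_leaf_below[OF r'(1) finite_parcs[OF r'(2)] arborescenceD(1)[OF r'(1)]] by blast
    then show ?thesis using finite_Leaf_branching[OF T'] by (simp add: card_gt_0_iff)
  qed
  have "0 < Max ?M" if "\<exists>T'. TL_out_branching D T L T'"
  proof -
    have "?M \<noteq> {}" using that by blast
    from Max_in[OF fin this] obtain T' where "TL_out_branching D T L T'" "Max ?M = card (Leaf T')"
      by blast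
    with pos show ?thesis by simp
  qed
  then show ?thesis
    by (cases "\<exists>T'. TL_out_branching D T L T'") (simp_all add: max_leaves_def)
qed

text \<open>A leaf has no arc in \<open>T\<close>, so the exception that \<open>hatD\<close> makes
  for arcs of \<open>T\<close> does not concern it.\<close>

lemma out_nbrs_hatD:
  assumes "triple D T L" "x \<in> Leaf T - L"
  shows "out_nbrs (hatD D T L) x = {y. (x, y) \<in> parcs D \<and> y \<notin> pverts T}"
proof -
  have "finite (parcs T)"
    using assms(1) by (rule tripleE) (rule finite_parcs)
  then show ?thesis using assms(2) mem_Leaf_iff unfolding out_nbrs_def hatD_def by fastforce
qed

text \<open>Internal vertices lie outside \<open>L\<close>, so \<open>hatD\<close> keeps their arcs
  to new vertices. The resulting condition does not mention \<open>L\<close> and thus persists when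
  \<open>L\<close> grows.\<close>

lemma saturated_iff:
  assumes "triple D T L"
  shows "saturated D T L \<longleftrightarrow> (\<forall>x y z. (x, z) \<in> parcs T \<longrightarrow> (x, y) \<in> parcs D \<longrightarrow> y \<in> pverts T)"
proof -
  obtain r where r: "arborescence r T" "parcs T \<subseteq> parcs D" "L \<inter> Int_verts T = {}"
    using assms by (rule tripleE)
  have "finite (parcs T)" using r(2) by (rule finite_parcs)
  then have Int: "x \<in> Int_verts T \<longleftrightarrow> (\<exists>z. (x, z) \<in> parcs T)" for x
    unfolding Int_verts_def using mem_Leaf_iff arborescenceD(2)[OF r(1)] by fastforce
  have "out_nbr_arcs (hatD D T L) x \<subseteq> parcs T \<longleftrightarrow> (\<forall>y. (x, y) \<in> parcs D \<longrightarrow> y \<in> pverts T)"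
    if "x \<in> Int_verts T" for x
    using that r(3) arborescenceD(3)[OF r(1)] unfolding out_nbr_arcs_def out_nbrs_def hatD_def
    by fastforce
  then show ?thesis unfolding saturated_def using Int by blast
qed

text \<open>All arcs from \<open>x\<close> to vertices outside \<open>T\<close> are added at once,
  so the new internal vertex \<open>x\<close> is saturated as well; the other new vertices are
  leaves.\<close>

lemma triple_extend:
  assumes tr: "triple D T L" and sat: "saturated D T L" and x: "x \<in> Leaf T - L"
    and T1: "T1 = add_arcs T (out_nbr_arcs (hatD D T L) x)"
  shows "triple D T1 L" "saturated D T1 L"
    "pverts T1 = pverts T \<union> out_nbrs (hatD D T L) x"
    "tree_root T1 = tree_root T"
proof -
  let ?S = "out_nbrs (hatD D T L) x"
  note S = out_nbrs_hatD[OF tr x]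
  obtain r where r: "arborescence r T" and sub: "parcs T \<subseteq> parcs D" "pverts T \<subseteq> pverts D"
    "L \<subseteq> pverts D" "\<forall>x \<in> L. \<forall>y. (x, y) \<notin> parcs T"
    using tr by (rule tripleE)
  have xT: "x \<in> pverts T" "\<And>z. (x, z) \<notin> parcs T"
    using x mem_Leaf_iff[OF finite_parcs[OF sub(1)]] by auto
  have T1': "parcs T1 = parcs T \<union> {x} \<times> ?S" "pverts T1 = pverts T \<union> ?S"
    using xT(1) unfolding T1 add_arcs_def out_nbr_arcs_eq by auto
  then show "pverts T1 = pverts T \<union> ?S" by simp
  have r1: "arborescence r T1"
    unfolding T1 out_nbr_arcs_eq using S by (intro arborescence_add_arcs[OF r xT(1)]) auto
  have sub1: "parcs T1 \<subseteq> parcs D" "pverts T1 \<subseteq> pverts D"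
    using sub S T1' in_arcsD2 by auto
  show tr1: "triple D T1 L"
    unfolding triple_iff[OF D] using r1 sub1 sub x T1' by auto
  show "saturated D T1 L"
    using sat S unfolding saturated_iff[OF tr] saturated_iff[OF tr1] T1' by blast
  show "tree_root T1 = tree_root T"
    using tree_root_arborescence[OF r] tree_root_arborescence[OF r1] sub(1) sub1(1)
      finite_parcs by metis
qed

text \<open>Hang all of \<open>?S\<close> under \<open>x\<close>. This is an admissible exchange
  because the ancestors of \<open>x\<close> lie in \<open>T\<close> while \<open>?S\<close> is
  disjoint from \<open>T\<close>. Only \<open>x\<close> could stop being a leaf, and it is not one
  in \<open>T'\<close>.\<close>

lemma branching_extend:
  assumes tr: "triple D T L" and x: "x \<in> Leaf T - L"
    and T': "TL_out_branching D T L T'" "x \<notin> Leaf T'"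
  shows "out_nbrs (hatD D T L) x \<noteq> {}"
    and "\<exists>T''. TL_out_branching D (add_arcs T (out_nbr_arcs (hatD D T L) x)) L T'' \<and>
      card (Leaf T') \<le> card (Leaf T'')"
proof -
  let ?S = "out_nbrs (hatD D T L) x" and ?T1 = "add_arcs T (out_nbr_arcs (hatD D T L) x)"
  note S = out_nbrs_hatD[OF tr x]
  obtain r where r: "arborescence r T" and sub: "parcs T \<subseteq> parcs D" "pverts T \<subseteq> pverts D"
    using tr by (rule tripleE)
  have T'': "arborescence r T'" "pverts T' = pverts D" "parcs T' \<subseteq> parcs D" "parcs T \<subseteq> parcs T'"
    "L \<subseteq> Leaf T'"
    using T'(1) unfolding TL_out_branching_iff[OF D r sub(1)] by auto
  have fin: "finite (parcs T)" "finite (parcs T')"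
    using sub(1) T''(3) finite_parcs by blast+
  have xT: "x \<in> pverts T" "\<And>z. (x, z) \<notin> parcs T" using x mem_Leaf_iff[OF fin(1)] by auto
  \<comment> \<open>An arc of \<open>T'\<close> from \<open>x\<close> into \<open>T\<close> would
    belong to \<open>T\<close>, where \<open>x\<close> is a leaf.\<close>
  have x_out: "y \<in> ?S" if "(x, y) \<in> parcs T'" for y
    using that arborescence_in_arc[OF r T''(1,4) that] xT T''(3) unfolding S by blast
  obtain y where "(x, y) \<in> parcs T'" using T'(2) mem_Leaf_iff[OF fin(2)] xT(1) sub(2) T''(2) by blast
  with x_out show "?S \<noteq> {}" by blast
  let ?R = "rehang T' x ?S"
  have "arborescence r ?R"
  proof (rule arborescence_rehang[OF T''(1)])
    show "x \<in> pverts T'" using xT sub T'' by blast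
    show "?S \<subseteq> pverts T'" using T''(2) in_arcsD2 unfolding S by blast
    show "(y, x) \<notin> (parcs T')\<^sup>*" if "y \<in> ?S" for y
      using arborescence_ancestor[OF r T''(1,4) _ xT(1)] that unfolding S by blast
  qed
  moreover have subR: "parcs ?R \<subseteq> parcs D" using T''(3) unfolding S rehang_def by auto
  moreover have "parcs ?T1 \<subseteq> parcs ?R"
    using T''(4) arborescenceD(3)[OF r] unfolding add_arcs_def out_nbr_arcs_eq S by auto
  moreover have Leaf: "Leaf T' \<subseteq> Leaf ?R"
  proof -
    have "Leaf T' - {x} \<subseteq> Leaf ?R" using fin(2) finite_parcs[OF subR] by (rule Leaf_rehang)
    then show ?thesis using T'(2) by auto
  qed
  moreover have "arborescence r ?T1"
    unfolding out_nbr_arcs_eq using S by (intro arborescence_add_arcs[OF r xT(1)]) auto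
  moreover have "parcs ?T1 \<subseteq> parcs D" using sub(1) unfolding add_arcs_def out_nbr_arcs_eq S by auto
  ultimately have "TL_out_branching D ?T1 L ?R"
    using T''(2,5) by (subst TL_out_branching_iff[OF D]) auto
  moreover from this have "card (Leaf T') \<le> card (Leaf ?R)"
    using Leaf finite_Leaf_branching card_mono by blast
  ultimately show "\<exists>T''. TL_out_branching D ?T1 L T'' \<and> card (Leaf T') \<le> card (Leaf T'')" by blast
qed

text \<open>If \<open>x\<close> starts a pendant path of \<open>T'\<close> and some branching \<open>Q\<close> has \<open>x\<close> as a leaf, then \<open>Q\<close>
  enters the path from outside by an arc \<open>(p, q)\<close>. Hanging \<open>q\<close> under \<open>p\<close> costs at most the leaf \<open>p\<close>
  and gains the predecessor of \<open>q\<close>, at which the pendant path now ends.\<close>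

lemma branching_pendant_path:
  assumes tr: "triple D T L" and x: "x \<in> Leaf T - L"
    and Q: "TL_out_branching D T (L \<union> {x}) Q"
    and "TL_out_branching D T L T'" and "c 0 = x"
    and "\<And>i. i < j \<Longrightarrow> out_nbrs T' (c i) = {c (Suc i)}" and "c j \<in> Leaf T'"
  shows "\<exists>T''. TL_out_branching D T (L \<union> {x}) T'' \<and> card (Leaf T') \<le> card (Leaf T'')"
  using assms(4-)
\<comment> \<open>Each exchange shortens the pendant path from \<open>j\<close> to some
  \<open>i' < j\<close>; at length 0 the vertex \<open>x\<close> is itself a leaf.\<close>
proof (induction j arbitrary: T' rule: less_induct)
  case (less j)
  obtain r where r: "arborescence r T" and sub: "parcs T \<subseteq> parcs D" "pverts T \<subseteq> pverts D"
    using tr by (rule tripleE)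
  have T': "arborescence r T'" "pverts T' = pverts D" "parcs T' \<subseteq> parcs D" "parcs T \<subseteq> parcs T'"
    "L \<subseteq> Leaf T'"
    using less.prems(1) unfolding TL_out_branching_iff[OF D r sub(1)] by auto
  have Q': "arborescence r Q" "pverts Q = pverts D" "parcs Q \<subseteq> parcs D" "L \<union> {x} \<subseteq> Leaf Q"
    using Q unfolding TL_out_branching_iff[OF D r sub(1)] by auto
  have fin: "finite (parcs T)" "finite (parcs T')" "finite (parcs Q)"
    using sub(1) T'(3) Q'(3) finite_parcs by blast+
  have c_iff: "(c i, y) \<in> parcs T' \<longleftrightarrow> y = c (Suc i)" if "i < j" for i y
    using less.prems(3)[OF that] unfolding out_nbrs_def by blast
  have c_last: "(c j, y) \<notin> parcs T'" for y using less.prems(4) mem_Leaf_iff[OF fin(2)] by blast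
  show ?case
  proof (cases "j = 0")
    case True
    then have "TL_out_branching D T (L \<union> {x}) T'"
      using less.prems(1,2,4) unfolding TL_out_branching_iff[OF D r sub(1)] by simp
    then show ?thesis by blast
  next
    case False
    \<comment> \<open>If the path entered \<open>T\<close>, the entering arc would lie in
      \<open>T\<close> and so would its tail; but the tail is the leaf \<open>x\<close> of
      \<open>T\<close> or an earlier vertex outside \<open>T\<close>.\<close>
    have c_out: "c i \<notin> pverts T" if "0 < i" "i \<le> j" for i
      using that
    proof (induction i)
      case (Suc i)
      show ?case
      proof
        assume "c (Suc i) \<in> pverts T"
        then have "(c i, c (Suc i)) \<in> parcs T"
          using arborescence_in_arc[OF r T'(1,4)] c_iff Suc.prems by auto
        then show False
          using Suc arborescenceD(2)[OF r] mem_Leaf_iff[OF fin(1)] x less.prems(2) by (cases i) auto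
      qed
    qed simp
    have c_less: "(c a, c b) \<in> (parcs T')\<^sup>+" if "a < b" "b \<le> j" for a b
      using that
    proof (induction b)
      case (Suc b)
      then have "(c b, c (Suc b)) \<in> parcs T'" using c_iff by simp
      then show ?case using Suc by (cases "a = b") (auto intro: trancl_into_trancl)
    qed simp
    then have c_neq: "c a \<noteq> c b" if "a < b" "b \<le> j" for a b
      using that arborescence_acyclic[OF T'(1)] unfolding acyclic_def by metis
    have c_below: "\<exists>b. a \<le> b \<and> b \<le> j \<and> y = c b" if "(c a, y) \<in> (parcs T')\<^sup>*" "a \<le> j" for a y
      using that(1)
    proof (induction rule: rtrancl_induct)
      case (step y z)
      then obtain b where b: "a \<le> b" "b \<le> j" "y = c b" by blast
      then have "b \<noteq> j" using step.hyps c_last by blast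
      then show ?case using b step.hyps c_iff[of b z] by (intro exI[of _ "Suc b"]) auto
    qed (use that in blast)
    \<comment> \<open>Starting at index 1 keeps \<open>r\<close> outside \<open>?C\<close>, even if
      \<open>r = x\<close>. The path of \<open>Q\<close> from \<open>r\<close> to \<open>c j\<close>
      must therefore enter \<open>?C\<close> by an arc.\<close>
    let ?C = "c ` {1..j}"
    have "c j \<in> pverts Q" using less.prems(4) mem_Leaf_iff[OF fin(2)] T'(2) Q'(2) by auto
    then have "(r, c j) \<in> (parcs Q)\<^sup>*" by (rule arborescenceD(6)[OF Q'(1)])
    moreover have "r \<notin> ?C" using c_out arborescenceD(1)[OF r] by fastforce
    moreover have "c j \<in> ?C" using False by simp
    ultimately have "\<exists>p q. (p, q) \<in> parcs Q \<and> p \<notin> ?C \<and> q \<in> ?C"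
      by (induction rule: converse_rtrancl_induct) blast+
    then obtain p i where p: "(p, c i) \<in> parcs Q" "p \<notin> ?C" and i: "0 < i" "i \<le> j" by force
    \<comment> \<open>As \<open>p\<close> has a child in \<open>Q\<close>, it is none of the
      prescribed leaves. In particular \<open>p\<close> is not \<open>c 0\<close>, so it lies off
      the whole pendant path.\<close>
    have "p \<notin> L \<union> {x}" using p(1) Q'(4) mem_Leaf_iff[OF fin(3)] by blast
    then have p_C: "p \<noteq> c a" if "a \<le> j" for a
      using p(2) that less.prems(2) by (cases a) auto
    \<comment> \<open>Everything below \<open>c i\<close> lies on the path and \<open>p\<close> does
      not, so this exchange creates no cycle.\<close>
    let ?R = "rehang T' p {c i}"
    have pD: "p \<in> pverts D" "(p, c i) \<in> parcs D" using p(1) Q'(3) in_arcsD1 by auto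
    have "arborescence r ?R"
    proof (rule arborescence_rehang[OF T'(1)])
      show "(y, p) \<notin> (parcs T')\<^sup>*" if "y \<in> {c i}" for y
        using that c_below[of i p] i(2) p_C by blast
    qed (use pD T'(2) in_arcsD2 in auto)
    moreover have subR: "parcs ?R \<subseteq> parcs D" using T'(3) pD unfolding rehang_def by auto
    moreover have "parcs T \<subseteq> parcs ?R"
      using T'(4) arborescenceD(3)[OF r] c_out[OF i] by auto
    moreover have finR: "finite (parcs ?R)" using subR by (rule finite_parcs)
    have LeafR: "Leaf T' - {p} \<subseteq> Leaf ?R" using fin(2) finR by (rule Leaf_rehang)
    obtain i' where i': "i = Suc i'" using i by (cases i) auto
    have end_R: "c i' \<in> Leaf ?R"
      using mem_Leaf_iff[OF finR] c_iff[of i'] p_C[of i'] i i' T'(1) arborescenceD(2)[OF T'(1)]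
      by auto
    have "L \<subseteq> Leaf ?R" using LeafR T'(5) \<open>p \<notin> L \<union> {x}\<close> by blast
    ultimately have R: "TL_out_branching D T L ?R"
      using T'(2) unfolding TL_out_branching_iff[OF D r sub(1)] by simp
    have "out_nbrs ?R (c a) = {c (Suc a)}" if "a < i'" for a
      using that c_iff[of a] c_neq[of "Suc a" i] p_C[of a] i i' unfolding out_nbrs_def by auto
    then obtain T'' where T'': "TL_out_branching D T (L \<union> {x}) T''" "card (Leaf ?R) \<le> card (Leaf T'')"
      using less.IH[OF _ R less.prems(2) _ end_R] i i' by auto
    have "c i' \<notin> Leaf T'" using c_iff[of i'] mem_Leaf_iff[OF fin(2)] i i' by auto
    \<comment> \<open>The new leaf \<open>c i'\<close> makes up for \<open>p\<close>, whether or not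
      \<open>p\<close> was a leaf of \<open>T'\<close>.\<close>
    then have "card (Leaf T') \<le> card (insert (c i') (Leaf T' - {p}))"
      using finite_Leaf_branching[OF less.prems(1)] by (auto simp: card_Diff_singleton_if)
    also have "\<dots> \<le> card (Leaf ?R)"
      using LeafR end_R finite_Leaf_branching[OF R] by (intro card_mono) auto
    finally show ?thesis using T'' by auto
  qed
qed

section \<open>Correctness of the algorithm\<close>

lemma triple_insert_leaf:
  assumes tr: "triple D T L" and x: "x \<in> Leaf T"
  shows "triple D T (L \<union> {x})"
proof -
  obtain r where "arborescence r T" "parcs T \<subseteq> parcs D" "pverts T \<subseteq> pverts D" "L \<subseteq> pverts D"
    "\<forall>x \<in> L. \<forall>y. (x, y) \<notin> parcs T"
    using tr by (rule tripleE)
  then show ?thesis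
    unfolding triple_iff[OF D] using x mem_Leaf_iff[OF finite_parcs] by auto
qed

lemma saturated_insert_leaf:
  assumes tr: "triple D T L" and x: "x \<in> Leaf T" and sat: "saturated D T L"
  shows "saturated D T (L \<union> {x})"
  using sat unfolding saturated_iff[OF tr] saturated_iff[OF triple_insert_leaf[OF tr x]] .

text \<open>The number of vertices outside the tree decreases: in an existing branching the forced
  vertex has a child, so the added set of arcs is nonempty. The invariant keeps the answer for all
  thresholds at once.\<close>

lemma extend_forced_Some:
  assumes tr: "triple D T L" and sat: "saturated D T L" and pick: "choice_rule pick"
    and ex: "TL_out_branching D T L T'"
  obtains T1 where "extend_forced pick D T L = Some T1" "triple D T1 L" "saturated D T1 L"
    "forced D T1 L = {}" "pverts T \<subseteq> pverts T1"
    "\<And>k. has_branching D T1 L k \<longleftrightarrow> has_branching D T L k"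
proof -
  define P where "P s \<longleftrightarrow> triple D s L \<and> saturated D s L \<and> pverts T \<subseteq> pverts s \<and>
    (\<forall>k. has_branching D s L k \<longleftrightarrow> has_branching D T L k)" for s
  let ?b = "\<lambda>T. forced D T L \<noteq> {}"
  let ?c = "\<lambda>T. add_arcs T (out_nbr_arcs (hatD D T L) (pick T L (forced D T L)))"
  let ?f = "\<lambda>s. card (pverts D - pverts s)"
  have step: "P (?c s) \<and> ?f (?c s) < ?f s" if P: "P s" and b: "?b s" for s
  proof -
    let ?x = "pick s L (forced D s L)" and ?S = "out_nbrs (hatD D s L) (pick s L (forced D s L))"
    have "?x \<in> forced D s L" using pick b unfolding choice_rule_def by blast
    then have x: "?x \<in> Leaf s - L" and zero: "max_leaves D s (L \<union> {?x}) = 0"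
      unfolding forced_def by auto
    have s: "triple D s L" "saturated D s L" "pverts T \<subseteq> pverts s"
      "\<And>k. has_branching D s L k \<longleftrightarrow> has_branching D T L k" using P unfolding P_def by auto
    have "triple D s (L \<union> {?x})" by (rule triple_insert_leaf[OF s(1)]) (use x in blast)
    note no_branching = max_leaves_eq_0_iff[OF this, THEN iffD1, OF zero]
    \<comment> \<open>Since \<open>?x\<close> is forced, \<open>branching_extend\<close> applies to
      every branching.\<close>
    have nonleaf: "?x \<notin> Leaf T'" if "TL_out_branching D s L T'" for T'
      using no_branching that branching_insert_leaf_iff[of D s L ?x T'] by blast
    note ext = triple_extend[OF s(1,2) x refl]
    have "has_branching D T L 0" using ex unfolding has_branching_def by blast
    then have "has_branching D s L 0" using s(4) by blast
    then have "?S \<noteq> {}"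
      using branching_extend(1)[OF s(1) x] nonleaf unfolding has_branching_def by blast
    moreover have S: "?S \<inter> pverts s = {}" "?S \<subseteq> pverts D"
      using out_nbrs_hatD[OF s(1) x] in_arcsD2 by auto
    ultimately have "?f (?c s) < ?f s"
      using pair_finite_verts by (intro psubset_card_mono) (auto simp: ext(3))
    moreover have "has_branching D (?c s) L k \<longleftrightarrow> has_branching D s L k" for k
    proof
      show "has_branching D s L k" if "has_branching D (?c s) L k"
        using that ext(4) by (elim has_branching_mono) auto
      show "has_branching D (?c s) L k" if "has_branching D s L k"
        using that branching_extend(2)[OF s(1) x] nonleaf unfolding has_branching_def
        by (meson le_trans)
    qed
    ultimately show ?thesis using ext s unfolding P_def by auto
  qed
  have "P T" using tr sat unfolding P_def by simp
  then obtain T1 where T1: "while_option ?b ?c T = Some T1"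
    using measure_while_option_Some[of P ?b ?c ?f T] step by blast
  have "P T1" using while_option_rule[where P = P, OF _ T1 \<open>P T\<close>] step by blast
  moreover have "\<not> ?b T1" using T1 by (rule while_option_stop)
  ultimately show thesis using that T1 unfolding P_def extend_forced_def by blast
qed

text \<open>An arc of \<open>T'\<close> leaving an internal vertex of \<open>T\<close> ends in
  \<open>T\<close> by saturation, and then it belongs to \<open>T\<close>.\<close>

lemma saturated_out_nbrs:
  assumes tr: "triple D T L" and sat: "saturated D T L" and T': "TL_out_branching D T L T'"
    and z: "(x, z) \<in> parcs T"
  shows "out_nbrs T' x = out_nbrs T x"
proof -
  obtain r where r: "arborescence r T" "parcs T \<subseteq> parcs D" using tr by (rule tripleE)
  have T'': "arborescence r T'" "parcs T' \<subseteq> parcs D" "parcs T \<subseteq> parcs T'"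
    using T' unfolding TL_out_branching_iff[OF D r] by auto
  have "(x, y) \<in> parcs T" if "(x, y) \<in> parcs T'" for y
  proof -
    have "(x, y) \<in> parcs D" using that T''(2) by blast
    then have "y \<in> pverts T" using sat z unfolding saturated_iff[OF tr] by blast
    with that show ?thesis by (rule arborescence_in_arc[OF r(1) T''(1,3)])
  qed
  then show ?thesis using T''(3) unfolding out_nbrs_def by blast
qed

text \<open>If \<open>c j\<close> were not a leaf of the branching, \<open>branching_extend\<close>
  would contradict \<open>no_ext\<close>. So the branching ends at \<open>c j\<close>, saturation
  makes the path from \<open>x\<close> to \<open>c j\<close> pendant, and
  \<open>branching_pendant_path\<close> applies.\<close>

lemma has_branching_saturated_leaf:
  assumes tr: "triple D T L" and x: "x \<in> Leaf T - L" and Q: "TL_out_branching D T (L \<union> {x}) Q"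
    and tr1: "triple D T1 L" and sat1: "saturated D T1 L"
    and T1: "parcs T \<subseteq> parcs T1" "tree_root T1 = tree_root T"
    and c: "c 0 = x" "\<And>i. i < j \<Longrightarrow> out_nbrs T1 (c i) = {c (Suc i)}" and y: "c j \<in> Leaf T1"
    and ex: "has_branching D T1 L k"
    and no_ext: "c j \<notin> L \<Longrightarrow>
      \<not> has_branching D (add_arcs T1 (out_nbr_arcs (hatD D T1 L) (c j))) L k \<or>
      out_nbrs (hatD D T1 L) (c j) = {}"
  shows "has_branching D T (L \<union> {x}) k"
proof -
  obtain T' where T': "TL_out_branching D T1 L T'" "k \<le> card (Leaf T')"
    using ex unfolding has_branching_def by blast
  have "c j \<in> Leaf T'"
  proof (rule ccontr)
    assume nonleaf: "c j \<notin> Leaf T'"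
    then have "c j \<notin> L" using T'(1) unfolding TL_out_branching_def by blast
    moreover from this have "c j \<in> Leaf T1 - L" using y by blast
    note branching_extend[OF tr1 this T'(1) nonleaf]
    ultimately show False using no_ext T'(2) unfolding has_branching_def by (meson le_trans)
  qed
  moreover have "out_nbrs T' (c i) = {c (Suc i)}" if "i < j" for i
  proof -
    have "(c i, c (Suc i)) \<in> parcs T1" using c(2)[OF that] unfolding out_nbrs_def by blast
    then show ?thesis using saturated_out_nbrs[OF tr1 sat1 T'(1)] c(2)[OF that] by simp
  qed
  moreover have "TL_out_branching D T L T'" using T'(1) T1 by (rule branching_mono) simp
  ultimately show ?thesis
    using branching_pendant_path[OF tr x Q, of T' c j] c(1) T'(2) unfolding has_branching_def
    by (meson le_trans)
qed

lemma T_root_Some: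
  assumes tr: "triple D T L" and sat: "saturated D T L" and x: "x \<in> Leaf T - L"
    and Q: "TL_out_branching D T (L \<union> {x}) Q"
  obtains R where "T_root D T L x = Some R"
    "card (Leaf R) < 2 \<Longrightarrow> has_branching D T L k \<Longrightarrow> has_branching D T (L \<union> {x}) k"
    "2 \<le> card (Leaf R) \<Longrightarrow> triple D (add_arcs T (parcs R)) L"
    "2 \<le> card (Leaf R) \<Longrightarrow> saturated D (add_arcs T (parcs R)) L"
    "2 \<le> card (Leaf R) \<Longrightarrow> pverts T \<subset> pverts (add_arcs T (parcs R))"
    "2 \<le> card (Leaf R) \<Longrightarrow> tree_root (add_arcs T (parcs R)) = tree_root T"
    "2 \<le> card (Leaf R) \<Longrightarrow> has_branching D T L k \<Longrightarrow>
      has_branching D T (L \<union> {x}) k \<or> has_branching D (add_arcs T (parcs R)) L k"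
proof -
  \<comment> \<open>Loop invariant: \<open>R\<close> consists of the arcs added so far and has the
    single leaf \<open>y\<close>; \<open>c\<close> describes the path from \<open>x\<close> to
    \<open>y\<close>. The last conjunct is the exchange alternative: make \<open>x\<close> a leaf or
    continue with the extended tree.\<close>
  define P where "P = (\<lambda>(T1, R, y). triple D T1 L \<and> saturated D T1 L \<and> T1 = add_arcs T (parcs R) \<and>
    tree_root T1 = tree_root T \<and> Leaf R = {y} \<and> fst ` parcs R \<subseteq> pverts R \<and>
    pverts R \<subseteq> pverts T1 \<and> y \<in> Leaf T1 \<and>
    (\<exists>c j. c 0 = x \<and> c j = y \<and> (\<forall>i < j. out_nbrs T1 (c i) = {c (Suc i)})) \<and>
    (has_branching D T L k \<longrightarrow> has_branching D T (L \<union> {x}) k \<or> has_branching D T1 L k))"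
  let ?b = "\<lambda>(T, R, x'). card (out_nbrs (hatD D T L) x') = 1"
  let ?c = "\<lambda>(T, R, x'). let y = the_elem (out_nbrs (hatD D T L) x')
             in (add_arcs T {(x', y)}, add_arcs R {(x', y)}, y)"
  let ?f = "\<lambda>(T1, R :: 'a pair_pre_digraph, y :: 'a). card (pverts D - pverts T1)"
  let ?s = "(T, \<lparr> pverts = {x}, parcs = {} \<rparr>, x)"
  \<comment> \<open>Serves both the loop body, where \<open>S\<close> is a singleton, and the final
    addition of all arcs after the loop.\<close>
  have P_extend:
    "triple D T2 L \<and> saturated D T2 L \<and> T2 = add_arcs T (parcs R2) \<and> tree_root T2 = tree_root T \<and>
     Leaf R2 = S \<and> fst ` parcs R2 \<subseteq> pverts R2 \<and> pverts R2 \<subseteq> pverts T2 \<and> S \<subseteq> Leaf T2 \<and>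
     pverts T1 \<subset> pverts T2 \<and> S \<subseteq> pverts D \<and> S \<inter> pverts T1 = {} \<and> y \<notin> L \<and>
     (has_branching D T L k \<longrightarrow> has_branching D T (L \<union> {x}) k \<or> has_branching D T2 L k)"
    if P: "P (T1, R, y)" and S: "S = out_nbrs (hatD D T1 L) y" "S \<noteq> {}"
      and T2: "T2 = add_arcs T1 ({y} \<times> S)" and R2: "R2 = add_arcs R ({y} \<times> S)" for T1 R y S T2 R2
  proof -
    have T1: "triple D T1 L" "saturated D T1 L" "T1 = add_arcs T (parcs R)"
      "tree_root T1 = tree_root T" "Leaf R = {y}" "fst ` parcs R \<subseteq> pverts R"
      "pverts R \<subseteq> pverts T1" "y \<in> Leaf T1"
      "has_branching D T L k \<Longrightarrow> has_branching D T (L \<union> {x}) k \<or> has_branching D T1 L k"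
      using P unfolding P_def by auto
    obtain c j where c: "c 0 = x" "c j = y" "\<And>i. i < j \<Longrightarrow> out_nbrs T1 (c i) = {c (Suc i)}"
      using P unfolding P_def by auto
    have "y \<notin> L" using S unfolding out_nbrs_def hatD_def by auto
    then have y: "y \<in> Leaf T1 - L" using T1(8) by blast
    have T2': "T2 = add_arcs T1 (out_nbr_arcs (hatD D T1 L) y)"
      unfolding T2 S(1) out_nbr_arcs_eq ..
    note ext = triple_extend[OF T1(1,2) y T2']
    have S': "S \<inter> pverts T1 = {}" "S \<subseteq> pverts D"
      unfolding S(1) out_nbrs_hatD[OF T1(1) y] using in_arcsD2 by auto
    have finS: "finite S" using S'(2) pair_finite_verts by (rule finite_subset)
    obtain r where r: "arborescence r T1" "parcs T1 \<subseteq> parcs D" using T1(1) by (rule tripleE)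
    have fin: "finite (parcs T1)" by (rule finite_parcs[OF r(2)])
    then have finR: "finite (parcs R)" unfolding T1(3) by simp
    have yR: "y \<in> pverts R" using T1(5) unfolding Leaf_def by blast
    have "Leaf R2 = S"
      unfolding R2 using Leaf_add_arcs[OF finR finS S(2) yR _ T1(6)] S'(1) T1(5,7) by auto
    moreover have "y \<in> pverts T1" "fst ` parcs T1 \<subseteq> pverts T1"
      using yR T1(7) arborescenceD(2)[OF r(1)] by auto
    then have "S \<subseteq> Leaf T2" unfolding T2 using Leaf_add_arcs[OF fin finS S(2) _ S'(1)] by auto
    moreover have "T2 = add_arcs T (parcs R2)"
      unfolding T2 R2 by (subst T1(3)) (simp add: add_arcs_add_arcs)
    moreover have "fst ` parcs R2 \<subseteq> pverts R2" using T1(6) yR unfolding R2 add_arcs_def by auto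
    moreover have "pverts R2 \<subseteq> pverts T2" using T1(7) unfolding R2 T2 add_arcs_def by auto
    moreover have "pverts T1 \<subset> pverts T2" using S' S unfolding ext(3) by auto
    moreover have "has_branching D T (L \<union> {x}) k \<or> has_branching D T2 L k"
      if "has_branching D T L k"
    proof -
      have "has_branching D T (L \<union> {x}) k" if "has_branching D T1 L k" "\<not> has_branching D T2 L k"
      proof (rule has_branching_saturated_leaf[OF tr x Q T1(1,2) _ T1(4) c(1,3) _ that(1)])
        show "parcs T \<subseteq> parcs T1" by (subst T1(3)) simp
      qed (use T1(8) c(2) that T2' in auto)
      then show ?thesis using that T1(9) by blast
    qed
    ultimately show ?thesis using ext T1(4) S' \<open>y \<notin> L\<close> by simp
  qed
  have step: "P (?c s) \<and> ?f (?c s) < ?f s" if P: "P s" and b: "?b s" for s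
  proof -
    obtain T1 R y where s: "s = (T1, R, y)" by (cases s)
    obtain z where z: "out_nbrs (hatD D T1 L) y = {z}"
      using b unfolding s by (auto simp: card_1_singleton_iff)
    define T2 R2 where "T2 = add_arcs T1 ({y} \<times> {z})" and "R2 = add_arcs R ({y} \<times> {z})"
    have cs: "?c s = (T2, R2, z)" unfolding s T2_def R2_def by (simp add: z)
    note ext = P_extend[OF P[unfolded s] z[symmetric] insert_not_empty T2_def R2_def]
    have "y \<in> Leaf T1" "triple D T1 L" using P unfolding s P_def by auto
    obtain r where r: "arborescence r T1" "parcs T1 \<subseteq> parcs D"
      using \<open>triple D T1 L\<close> by (rule tripleE)
    have y: "(y, w) \<notin> parcs T1" for w
      using \<open>y \<in> Leaf T1\<close> mem_Leaf_iff[OF finite_parcs[OF r(2)]] by blast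
    obtain c j where c: "c 0 = x" "c j = y" "\<And>i. i < j \<Longrightarrow> out_nbrs T1 (c i) = {c (Suc i)}"
      using P unfolding s P_def by auto
    let ?c' = "c(Suc j := z)"
    have "out_nbrs T2 (?c' i) = {?c' (Suc i)}" if "i < Suc j" for i
    proof (cases "i = j")
      case True
      then show ?thesis using y c(2) unfolding T2_def out_nbrs_def by auto
    next
      case False
      then have "i < j" using that by simp
      \<comment> \<open>Earlier path vertices have children in \<open>T1\<close> and
        \<open>y\<close> has none, so the new arc at \<open>y\<close> does not change their
        out-neighbours.\<close>
      then have "c i \<noteq> y" using c(3)[of i] y unfolding out_nbrs_def by auto
      then show ?thesis using c(3)[OF \<open>i < j\<close>] \<open>i < j\<close> unfolding T2_def out_nbrs_def by auto
    qed
    then have "\<exists>c j. c 0 = x \<and> c j = z \<and> (\<forall>i < j. out_nbrs T2 (c i) = {c (Suc i)})"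
      using c(1) by (intro exI[of _ ?c'] exI[of _ "Suc j"]) auto
    then have "P (?c s)" unfolding cs P_def prod.case using ext
      by - (elim conjE, intro conjI; (assumption | simp))
    moreover have "?f (?c s) < ?f s"
    proof -
      have tr2: "triple D T2 L" and psub: "pverts T1 \<subset> pverts T2"
        using ext by - (elim conjE, assumption)+
      have "pverts T2 \<subseteq> pverts D" using tr2 by (rule tripleE)
      with psub have "pverts D - pverts T2 \<subset> pverts D - pverts T1" by blast
      then show ?thesis unfolding cs unfolding s using pair_finite_verts by (simp add: psubset_card_mono)
    qed
    ultimately show ?thesis by blast
  qed
  have "P ?s"
  proof -
    have "x \<in> pverts T" using x unfolding Leaf_def by blast
    moreover have "Leaf \<lparr> pverts = {x}, parcs = {} \<rparr> = {x}" by (auto simp: mem_Leaf_iff)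
    moreover have "\<exists>c j. c 0 = x \<and> c j = x \<and> (\<forall>i < j. out_nbrs T (c i) = {c (Suc i)})"
      by (intro exI[of _ "\<lambda>_. x"] exI[of _ 0]) simp
    ultimately show ?thesis unfolding P_def using tr sat x by simp
  qed
  then obtain s where s: "while_option ?b ?c ?s = Some s"
    using measure_while_option_Some[of P ?b ?c ?f ?s] step by blast
  have "P s" using while_option_rule[where P = P, OF _ s \<open>P ?s\<close>] step by blast
  moreover have stop: "\<not> ?b s" using s by (rule while_option_stop)
  moreover obtain T1 R y where s': "s = (T1, R, y)" by (cases s)
  ultimately have P: "P (T1, R, y)" by simp
  let ?S = "out_nbrs (hatD D T1 L) y"
  let ?R = "add_arcs R ({y} \<times> ?S)"
  have T_root: "T_root D T L x = Some ?R"
    unfolding T_root_def s s' by (simp add: out_nbr_arcs_eq)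
  show thesis
  \<comment> \<open>If the loop stops with no out-neighbour, \<open>R\<close> has one leaf and no
    extension at \<open>y\<close> is possible, so \<open>x\<close> can be made a leaf. Otherwise
    there are at least two out-neighbours, since exactly one would have continued the loop.\<close>
  proof (cases "?S = {}")
    case True
    have T1: "triple D T1 L" "saturated D T1 L" "T1 = add_arcs T (parcs R)"
      "tree_root T1 = tree_root T" "Leaf R = {y}" "y \<in> Leaf T1"
      "has_branching D T L k \<Longrightarrow> has_branching D T (L \<union> {x}) k \<or> has_branching D T1 L k"
      using P unfolding P_def by auto
    obtain c j where c: "c 0 = x" "c j = y" "\<And>i. i < j \<Longrightarrow> out_nbrs T1 (c i) = {c (Suc i)}"
      using P unfolding P_def by auto
    have "has_branching D T (L \<union> {x}) k" if "has_branching D T1 L k"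
    proof (rule has_branching_saturated_leaf[OF tr x Q T1(1,2) _ T1(4) c(1,3) _ that])
      show "parcs T \<subseteq> parcs T1" by (subst T1(3)) simp
    qed (use T1(6) c(2) True in auto)
    then show thesis using that[OF T_root] T1(5,7) True by auto
  next
    case False
    note ext = P_extend[OF P refl False refl refl]
    have "?S \<subseteq> pverts D" and psub: "pverts T1 \<subset> pverts (add_arcs T1 ({y} \<times> ?S))"
      and eq: "add_arcs T1 ({y} \<times> ?S) = add_arcs T (parcs ?R)"
      using ext by - (elim conjE, assumption)+
    then have "finite ?S" using pair_finite_verts finite_subset by metis
    then have "2 \<le> card ?S"
      using False stop unfolding s' by (cases "card ?S") auto
    moreover have "pverts T \<subset> pverts (add_arcs T (parcs ?R))"
    proof -
      have "pverts T \<subseteq> pverts T1" using P unfolding P_def add_arcs_def by auto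
      then show ?thesis using psub unfolding eq by blast
    qed
    ultimately show thesis using that[OF T_root] ext unfolding eq by simp
  qed
qed

text \<open>No arc of \<open>T'\<close> leaves the vertex set of \<open>T\<close>: leaves of
  \<open>T\<close> must stay leaves, and internal vertices are saturated.\<close>

lemma branching_unique_if_leaves_fixed:
  assumes tr: "triple D T L" and sat: "saturated D T L" and "Leaf T \<subseteq> L"
    and T': "TL_out_branching D T L T'"
  shows "T' = T"
proof -
  obtain r where r: "arborescence r T" "parcs T \<subseteq> parcs D" "pverts T \<subseteq> pverts D"
    using tr by (rule tripleE)
  have T'': "arborescence r T'" "pverts T' = pverts D" "parcs T' \<subseteq> parcs D" "parcs T \<subseteq> parcs T'"
    "L \<subseteq> Leaf T'"
    using T' unfolding TL_out_branching_iff[OF D r(1,2)] by auto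
  have "v \<in> pverts T" if "(r, v) \<in> (parcs T')\<^sup>*" for v
    using that
  proof (induction rule: rtrancl_induct)
    case base
    show ?case by (rule arborescenceD(1)[OF r(1)])
  next
    case (step y z)
    have "y \<notin> Leaf T"
      using step.hyps assms(3) T''(5) mem_Leaf_iff[OF finite_parcs[OF T''(3)]] by blast
    then obtain w where "(y, w) \<in> parcs T"
      using step.IH mem_Leaf_iff[OF finite_parcs[OF r(2)]] by blast
    then show ?case using step.hyps T''(3) sat unfolding saturated_iff[OF tr] by blast
  qed
  then have verts: "pverts T' = pverts T" using arborescenceD(6)[OF T''(1)] T''(2) r(3) by blast
  have "parcs T' \<subseteq> parcs T"
    using arborescence_in_arc[OF r(1) T''(1,4)] arborescenceD(3)[OF T''(1)] verts by auto
  then show ?thesis using verts T''(4) by (intro pair_pre_digraph.equality) auto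
qed

text \<open>By \<open>card_Leaf_mono\<close>, any branching has at least as many leaves as the tree
  it contains.\<close>

lemma has_branching_if_card_Leaf:
  assumes tr: "triple D T L" and ex: "has_branching D T L 0" and "k \<le> card (Leaf T)"
  shows "has_branching D T L k"
proof -
  obtain T' where T': "TL_out_branching D T L T'" using ex unfolding has_branching_def by blast
  obtain r where r: "arborescence r T" "parcs T \<subseteq> parcs D" "pverts T \<subseteq> pverts D"
    using tr by (rule tripleE)
  have T'': "arborescence r T'" "pverts T' = pverts D" "parcs T' \<subseteq> parcs D" "parcs T \<subseteq> parcs T'"
    using T' unfolding TL_out_branching_iff[OF D r(1,2)] by auto
  have "card (Leaf T) \<le> card (Leaf T')"
    using card_Leaf_mono[OF r(1) T''(1,4) finite_parcs[OF T''(3)]] pair_finite_verts r(3) T''(2)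
    by simp
  then show ?thesis using T' assms(3) unfolding has_branching_def by (meson le_trans)
qed

lemma has_branching_if_card_fixed:
  assumes "has_branching D T L 0" "k \<le> card L"
  shows "has_branching D T L k"
proof -
  obtain T' where T': "TL_out_branching D T L T'" using assms(1) unfolding has_branching_def by blast
  have "card L \<le> card (Leaf T')"
    using finite_Leaf_branching[OF T'] T' unfolding TL_out_branching_def by (auto intro: card_mono)
  then show ?thesis using T' assms(2) unfolding has_branching_def by (meson le_trans)
qed

text \<open>Termination and correctness are proved together, as a diverging run yields
  \<open>None\<close>.\<close>

lemma algA_correct:
  assumes pick: "choice_rule pick" and "triple D T L" "saturated D T L"
  shows "\<exists>b. algA pick k D T L = Some b \<and> (b = YES \<longleftrightarrow> has_branching D T L k)"
  using assms(2,3)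
\<comment> \<open>The first recursive call enlarges \<open>L\<close>, the second enlarges
  \<open>T\<close>; forced extensions can only decrease the second summand.\<close>
proof (induction "card (pverts D - L) + card (pverts D - pverts T)" arbitrary: T L rule: less_induct)
  case less
  note tr = less.prems(1) and sat = less.prems(2)
  show ?case
  proof (cases "\<exists>T'. TL_out_branching D T L T'")
    case False
    then have "max_leaves D T L = 0" using max_leaves_eq_0_iff[OF tr] by blast
    then have "algA pick k D T L = Some NO" by (subst algA.simps) simp
    then show ?thesis using False unfolding has_branching_def by auto
  next
    case True
    then have nonzero: "max_leaves D T L \<noteq> 0" using max_leaves_eq_0_iff[OF tr] by blast
    obtain T' where "TL_out_branching D T L T'" using True by blast
    then obtain T1 where T1: "extend_forced pick D T L = Some T1" "triple D T1 L" "saturated D T1 L"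
        "forced D T1 L = {}" "pverts T \<subseteq> pverts T1"
        "\<And>k. has_branching D T1 L k \<longleftrightarrow> has_branching D T L k"
      by (rule extend_forced_Some[OF tr sat pick]) blast
    have "has_branching D T L 0" using True unfolding has_branching_def by blast
    then have ex: "has_branching D T1 L 0" using T1(6) by blast
    note rec = algA.simps[of pick k D T L]
    show ?thesis
    proof (cases "k \<le> card L \<or> k \<le> card (Leaf T1)")
      case True
      then have "algA pick k D T L = Some YES" by (subst rec) (auto simp: nonzero T1(1))
      moreover have "has_branching D T L k"
        using True has_branching_if_card_fixed[OF ex] has_branching_if_card_Leaf[OF T1(2) ex]
        unfolding T1(6) by blast
      ultimately show ?thesis by simp
    next
      case small: False
      show ?thesis
      proof (cases "Leaf T1 \<subseteq> L")
        case True
        then have "algA pick k D T L = Some NO" by (subst rec) (use small in \<open>auto simp: nonzero T1(1)\<close>)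
        \<comment> \<open>The only possible branching is \<open>T1\<close> itself, and it has fewer
          than \<open>k\<close> leaves.\<close>
        moreover have "\<not> has_branching D T1 L k"
          using branching_unique_if_leaves_fixed[OF T1(2,3) True] small unfolding has_branching_def by blast
        ultimately show ?thesis unfolding T1(6) by simp
      next
        case False
        define x where "x = pick T1 L (Leaf T1 - L)"
        have x: "x \<in> Leaf T1 - L"
          using False pick[unfolded choice_rule_def, rule_format, of "Leaf T1 - L"]
          unfolding x_def by blast
        have trx: "triple D T1 (L \<union> {x})" by (rule triple_insert_leaf[OF T1(2)]) (use x in blast)
        \<comment> \<open>Exhausting the forced vertices pays off here: it yields the branching
          \<open>Q\<close> with leaf \<open>x\<close> that the exchange along the pendant path
          requires.\<close>
        have "max_leaves D T1 (L \<union> {x}) \<noteq> 0" using T1(4) x unfolding forced_def by auto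
        then obtain Q where Q: "TL_out_branching D T1 (L \<union> {x}) Q"
          using max_leaves_eq_0_iff[OF trx] by metis
        obtain R where R: "T_root D T1 L x = Some R"
          "card (Leaf R) < 2 \<Longrightarrow> has_branching D T1 L k \<Longrightarrow> has_branching D T1 (L \<union> {x}) k"
          "2 \<le> card (Leaf R) \<Longrightarrow> triple D (add_arcs T1 (parcs R)) L"
          "2 \<le> card (Leaf R) \<Longrightarrow> saturated D (add_arcs T1 (parcs R)) L"
          "2 \<le> card (Leaf R) \<Longrightarrow> pverts T1 \<subset> pverts (add_arcs T1 (parcs R))"
          "2 \<le> card (Leaf R) \<Longrightarrow> tree_root (add_arcs T1 (parcs R)) = tree_root T1"
          "2 \<le> card (Leaf R) \<Longrightarrow> has_branching D T1 L k \<Longrightarrow>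
            has_branching D T1 (L \<union> {x}) k \<or> has_branching D (add_arcs T1 (parcs R)) L k"
          using T_root_Some[OF T1(2,3) x Q, of k] by blast
        let ?T2 = "add_arcs T1 (parcs R)"
        have subT1: "pverts T1 \<subseteq> pverts D" using T1(2) by (rule tripleE)
        have card1: "card (pverts D - pverts T1) \<le> card (pverts D - pverts T)"
          using T1(5) pair_finite_verts by (intro card_mono) auto
        have "x \<in> pverts D" using x subT1 unfolding Leaf_def by blast
        then have "card (pverts D - (L \<union> {x})) < card (pverts D - L)"
          using x pair_finite_verts by (intro psubset_card_mono) auto
        then obtain b1 where b1: "algA pick k D T1 (L \<union> {x}) = Some b1"
            "b1 = YES \<longleftrightarrow> has_branching D T1 (L \<union> {x}) k"
          using less.hyps[OF _ trx saturated_insert_leaf[OF T1(2) _ T1(3)]] x card1 by fastforce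
        have "\<exists>b2. (if 2 \<le> card (Leaf R) then algA pick k D ?T2 L else Some NO) = Some b2 \<and>
          (b2 = YES \<longleftrightarrow> 2 \<le> card (Leaf R) \<and> has_branching D ?T2 L k)"
        proof (cases "2 \<le> card (Leaf R)")
          case True
          have "pverts ?T2 \<subseteq> pverts D" using R(3)[OF True] by (rule tripleE)
          then have "card (pverts D - pverts ?T2) < card (pverts D - pverts T1)"
            using R(5)[OF True] pair_finite_verts by (intro psubset_card_mono) auto
          then show ?thesis using less.hyps[OF _ R(3,4)[OF True]] True card1 by simp
        qed simp
        then obtain b2 where b2:
            "(if 2 \<le> card (Leaf R) then algA pick k D ?T2 L else Some NO) = Some b2"
            "b2 = YES \<longleftrightarrow> 2 \<le> card (Leaf R) \<and> has_branching D ?T2 L k"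
          by blast
        have "algA pick k D T L = Some (if b1 = YES \<or> b2 = YES then YES else NO)"
          by (subst rec)
            (use small False in \<open>simp add: nonzero T1(1) R(1) b1(1)[simplified] b2(1) flip: x_def\<close>)
        \<comment> \<open>Soundness holds because both calls only add constraints; completeness is
          the exchange alternative obtained from \<open>T_root_Some\<close>.\<close>
        moreover have "b1 = YES \<or> b2 = YES \<longleftrightarrow> has_branching D T1 L k"
        proof
          assume "b1 = YES \<or> b2 = YES"
          then show "has_branching D T1 L k"
          proof
            assume "b1 = YES"
            then have "has_branching D T1 (L \<union> {x}) k" using b1(2) by blast
            then show ?thesis by (rule has_branching_mono) auto
          next
            assume "b2 = YES"
            then have "has_branching D ?T2 L k" "2 \<le> card (Leaf R)" using b2(2) by auto
            then show ?thesis using R(6) by (elim has_branching_mono) auto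
          qed
        next
          assume "has_branching D T1 L k"
          then show "b1 = YES \<or> b2 = YES" using R(2,7) b1(2) b2(2) by linarith
        qed
        ultimately show ?thesis unfolding T1(6) by auto
      qed
    qed
  qed
qed

end

theorem theorem1:
  fixes D T :: "'a pair_pre_digraph" and L :: "'a set" and k :: nat and pick :: "'a choice"
  assumes "triple D T L"
    and "saturated D T L"
    and "k > 0"
    and "choice_rule pick"
  shows "(\<exists>T'. TL_out_branching D T L T' \<and> card (Leaf T') \<ge> k) \<longleftrightarrow>
         algA pick k D T L = Some YES"
proof -
  have "pair_digraph D" using assms(1) unfolding triple_def by blast
  from algA_correct[OF this assms(4,1,2), of k] show ?thesis unfolding has_branching_def by auto
qed

end
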